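(* Suppose the feasibility, regularity and consistent-output assumptions stated in the context hold and $\{H^k\}$ is bounded. Let $(x^\infty,v^\infty)$, $v^\infty=(v_1^\infty,\dots,v_N^\infty)$, be a limit point of the sequence $\{(x^k,v^k)\}$ generated by the two-stage trust-region algorithm described in the context, with its merit function $\phi$ and model $m$. If $\nabla_{v_i}F_i(v_i^\infty;x^\infty)$ is nonsingular for each $i=1,\dots,N$, then $x^\infty$ is a stationary point of $\phi(\cdot;(x^\infty,v^\infty))$.
   Context: Two-stage problem: the first stage is $\min_{x\in\mathbb{R}^{n_0}} f_0(x)+\sum_{i=1}^N\hat f_i(x)$ subject to $c_0(x)\le 0$; the $i$-th second-stage problem (subproblem) parameterized by $x$ is $\min_{y_i\in\mathbb{R}^{n_i}} f_i(y_i;x)$ subject to $c_i(y_i;x)\le 0$, with $f_i:\mathbb{R}^{n_i}\times\mathbb{R}^{n_0}\to\mathbb{R}$ and $c_i:\mathbb{R}^{n_i}\times\mathbb{R}^{n_0}\to\mathbb{R}^{m_i}$, not necessarily convex. Fix a smoothing parameter $\mu>0$. The smoothed (barrier) subproblem is $$\min_{y_i,s_i,\tilde x_i} f_i(y_i;\tilde x_i)-\mu\sum_j\ln(s_{ij})\quad\text{s.t.}\quad c_i(y_i;\tilde x_i)+s_i=0\ [\lambda_i],\quad \tilde x_i-x=0\ [\eta_i],$$ with multipliers in brackets. Let $v_i=(y_i,\tilde x_i,s_i,\lambda_i,\eta_i)\in\mathbb{R}^{n_{v_i}}$, $\mathcal{L}_i=f_i(y_i;\tilde x_i)+(c_i(y_i;\tilde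 x_i)+s_i)^T\lambda_i+(\tilde x_i-x)^T\eta_i$, and $$F_i(v_i;x)=\big(\nabla_{y_i}\mathcal{L}_i,\ \nabla_{\tilde x_i}\mathcal{L}_i,\ s_i\circ\lambda_i-\mu e,\ c_i(y_i;\tilde x_i)+s_i,\ \tilde x_i-x\big),$$ where $\circ$ is the componentwise product and $e$ the all-ones vector. Let $\mathcal{S}_i$ be the set of $(x,v_i)\in\mathbb{R}^{n_0}\times\mathbb{R}^{n_{v_i}}$ with $F_i(v_i;x)=0$ (and $s_i>0$, $\lambda_i>0$). A point $(x,v_i)\in\mathcal{S}_i$ is a nondegenerate stationary point if $\nabla_{v_i}F_i(v_i;x)$ is nonsingular. A solution map is a continuous map $v_i^*:U\to\mathbb{R}^{n_{v_i}}$ on a neighborhood $U\subset\mathbb{R}^{n_0}$ with $(x,v_i^*(x))\in\mathcal{S}_i$ for all $x\in U$; it has reference point $(\bar x,\bar v_i)$ if $v_i^*(\bar x)=\bar v_i$. $B(\cdot,r)$ is the open Euclidean ball. For each nondegenerate $(\bar x,\bar v_i)\in\mathcal{S}_i$ there are radii $r_1\ge r_2>0$ (fixed once and for all) such that there is a unique $C^1$ solution map $v_i^*(\cdot;(\bar x,\bar v_i))=(y_i^*,\tilde x_i^*,s_i^*,\lambda_i^*,\eta_i^* )(\cdot;(\bar x,\bar v_i))$ on $B(\bar x,r_1)$ with reference point $(\bar x,\bar v_i)$, and its graph is the zero level set of $F_i$ inside $B((\bar x,\bar v_i),r_2)$. Local second-stage functions near $\bar x$: for solution smoothing, $\hat f_i(x;(\bar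 x,\bar v_i))=f_i(y_i^*(x;(\bar x,\bar v_i));x)$; for objective smoothing, $\hat f_i(x;(\bar x,\bar v_i))=f_i(y_i^*(x;(\bar x,\bar v_i));x)-\mu\sum_j\ln(s_{ij}^*(x;(\bar x,\bar v_i)))$. Either choice is allowed. For $\pi>0$ and $\bar v=(\bar v_1,\dots,\bar v_N)$ define near $\bar x$ $$\phi(x;(\bar x,\bar v))=f_0(x)+\sum_{i=1}^N\hat f_i(x;(\bar x,\bar v_i))+\pi\|[c_0(x)]^+\|_1,$$ where $[\cdot]^+$ is the componentwise positive part. The subdifferential of a function $\phi$ is $\partial\phi(x)=\{g: g^Td\le\lim_{t\downarrow0}(\phi(x+td)-\phi(x))/t\ \text{for all }d\in\mathbb{R}^{n_0}\}$; $x$ is a stationary point of $\phi$ if the minimum-norm element of $\partial\phi(x)$ is zero, i.e. $0\in\partial\phi(x)$. Subproblem solver: given an input $x$ and a starting point, it returns $v_i$ with $(x,v_i)\in\mathcal{S}_i$, together with the value $\hat f_i(x)$, equal to $f_i(y_i;x)$ (solution smoothing) or $f_i(y_i;x)-\mu\sum_j\ln(s_{ij})$ (objective smoothing), and the corresponding gradient $\nabla\hat f_i(x)$ (the gradient at $x$ of the local function $\hat f_i(\cdot;(x,v_i))$; equal to $-\eta_i$ for objective smoothing). Two-stage trust-region algorithm. Parameters: $0<\Delta^0\le\bar\Delta$, $\pi>0$, $0<\eta_1\le\eta_2<1$, $0<1/\gamma_3\le\gamma_1\le\gamma_2<1<\gamma_3$. Initialization: given $x^0$ and starting points, call the subproblem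 solvers at $x^0$ to obtain $v_i^0$ with $(x^0,v_i^0)\in\mathcal{S}_i$, and write $v^k=(v_1^k,\dots,v_N^k)$. For $k=0,1,2,\dots$: choose a symmetric matrix $H^k$; let $p^k$ be an optimal solution of $\min_p m(x^k,H^k,p)$ s.t. $\|p\|\le\Delta^k$, where $$m(x^k,H^k,p)=f_0(x^k)+\sum_i\hat f_i(x^k)+\nabla\Big[f_0(x^k)+\sum_i\hat f_i(x^k)\Big]^Tp+\tfrac12p^TH^kp+\pi\|[c_0(x^k)+\nabla c_0(x^k)^Tp]^+\|_1,$$ with $\hat f_i(x^k),\nabla\hat f_i(x^k)$ based on $v_i^k$; if $p^k=0$, terminate and return $x^k$; otherwise call the subproblem solver at $x^k+p^k$ with starting point $v_i^k$ to get $\tilde v_i^k$ with $(x^k+p^k,\tilde v_i^k)\in\mathcal{S}_i$ and the value $\hat f_i(x^k+p^k)$; compute $$\rho^k=\frac{\phi(x^k)-\phi(x^k+p^k)}{m(x^k,H^k,0)-m(x^k,H^k,p^k)},\qquad \phi(x)=f_0(x)+\sum_i\hat f_i(x)+\pi\|[c_0(x)]^+\|_1,$$ using the values returned by the solver; if $\rho^k\ge\eta_1$ set $x^{k+1}=x^k+p^k$, $v_i^{k+1}=\tilde v_i^k$, otherwise $x^{k+1}=x^k$, $v_i^{k+1}=v_i^k$; choose $\Delta^{k+1}\in[\min\{\gamma_3\Delta^k,\bar\Delta\},\bar\Delta]$ if $\rho^k\ge\eta_2$, $\Delta^{k+1}\in[\gamma_2\Delta^k,\Delta^k]$ if $\rho^k\in[\eta_1,\eta_2)$,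 and $\Delta^{k+1}\in[\gamma_1\Delta^k,\gamma_2\Delta^k]$ if $\rho^k<\eta_1$. Feasibility assumption: for any $x$ sent to the subproblems by the first-stage problem, the subproblem parameterized by $x$ is feasible and the subproblem solver always returns a KKT point of the smoothed subproblem. Regularity assumption: $f_0,c_0$ are $C^1$ with locally Lipschitz continuous first derivatives. If objective smoothing is used, $f_i(\cdot;\cdot)$ and $c_i(\cdot;\cdot)$ are $C^2$ with locally Lipschitz continuous second derivatives; if solution smoothing is used, they are $C^3$. Consistent-output assumption: for every nondegenerate $(\bar x,\bar v_i)\in\mathcal{S}_i$ there exists $r_3>0$ such that: if $v_i^k$ is the stationary point computed by the solver for $x^k$ and $(x^k,v_i^k)\in\mathcal{S}_i\cap B((\bar x,\bar v_i),r_3)$, then when the solver is started from $v_i^k$ for an input $x^+=x^k+p$ with $\|p\|\le r_3$, the stationary point $v_i^+$ it computes satisfies $(x^+,v_i^+)\in B((\bar x,\bar v_i),r_2)$. *)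

theory Defs
  imports "HOL-Analysis.Analysis"
begin

section \<open>Smoothness classes and gradients\<close>

definition locally_lipschitz :: "('a::metric_space \<Rightarrow> 'b::metric_space) \<Rightarrow> bool" where
  "locally_lipschitz f \<longleftrightarrow> (\<forall>x. \<exists>u>0. \<exists>L. L-lipschitz_on (ball x u) f)"

definition is_derivative_on ::
    "'a set \<Rightarrow> ('a::real_normed_vector \<Rightarrow> 'b::real_normed_vector) \<Rightarrow> ('a \<Rightarrow> 'a \<Rightarrow>\<^sub>L 'b) \<Rightarrow> bool" where
  "is_derivative_on U f f' \<longleftrightarrow> (\<forall>x\<in>U. (f has_derivative blinfun_apply (f' x)) (at x))"

definition C1_on :: "'a set \<Rightarrow> ('a::real_normed_vector \<Rightarrow> 'b::real_normed_vector) \<Rightarrow> bool" where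
  "C1_on U f \<longleftrightarrow> (\<exists>f'. is_derivative_on U f f' \<and> continuous_on U f')"

definition C3 :: "('a::real_normed_vector \<Rightarrow> 'b::real_normed_vector) \<Rightarrow> bool" where
  "C3 f \<longleftrightarrow> (\<exists>f' f'' f'''. is_derivative_on UNIV f f' \<and> is_derivative_on UNIV f' f''
      \<and> is_derivative_on UNIV f'' f''' \<and> continuous_on UNIV f''')"

text \<open>Continuously differentiable once (twice) with locally Lipschitz first (second) derivative.\<close>

definition C1_lip :: "('a::real_normed_vector \<Rightarrow> 'b::real_normed_vector) \<Rightarrow> bool" where
  "C1_lip f \<longleftrightarrow> (\<exists>f'. is_derivative_on UNIV f f' \<and> locally_lipschitz f')"

definition C2_lip :: "('a::real_normed_vector \<Rightarrow> 'b::real_normed_vector) \<Rightarrow> bool" where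
  "C2_lip f \<longleftrightarrow> (\<exists>f' f''. is_derivative_on UNIV f f' \<and> is_derivative_on UNIV f' f''
      \<and> locally_lipschitz f'')"

definition grad :: "('a::real_inner \<Rightarrow> real) \<Rightarrow> 'a \<Rightarrow> 'a" where
  "grad f x = (THE g. GDERIV f x :> g)"

lemma grad_eq:
  assumes "GDERIV f x :> g"
  shows "grad f x = g"
  unfolding grad_def
proof (rule the_equality)
  show "GDERIV f x :> g" by (fact assms)
next
  fix h assume "GDERIV f x :> h"
  then have "(\<lambda>d. d \<bullet> h) = (\<lambda>d. d \<bullet> g)"
    using assms unfolding gderiv_def by (rule has_derivative_unique)
  then have "(h - g) \<bullet> h = (h - g) \<bullet> g"
    by (rule fun_cong)
  then have "(h - g) \<bullet> (h - g) = 0"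
    by (simp only: inner_diff_right[of "h - g" h g])
  then show "h = g"
    by simp
qed

definition pos_part :: "real^'q \<Rightarrow> real^'q" where
  "pos_part z = (\<chi> j. max 0 (z $ j))"

definition norm1 :: "real^'q \<Rightarrow> real" where
  "norm1 z = (\<Sum>j\<in>UNIV. \<bar>z $ j\<bar>)"


section \<open>The two-stage problem and its smoothed subproblems\<close>

text \<open>
  The dimensions of the subproblems vary with their index i in {1..N}.  The space of the i-th
  second-stage variable is the coordinate subspace of real^'n belonging to the index set yidx P i
  (so its dimension is the cardinality of yidx P i), and likewise the space of the i-th constraint
  values is the coordinate subspace of real^'m belonging to cidx P i.  The types 'n and 'm only
  provide an upper bound on these dimensions; the index sets are arbitrary, possibly empty, subsets.
  The functions fs P i and cs P i are extended to the whole type by ignoring the coordinates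
  of y outside yidx P i, see well_formed below; they thus are functions of the coordinates in
  yidx P i only, and their gradients with respect to y lie in the coordinate subspace.
\<close>

record ('p::finite, 'q::finite, 'n::finite, 'm::finite) two_stage =
  N :: nat
  f0 :: "real^'p \<Rightarrow> real"
  c0 :: "real^'p \<Rightarrow> real^'q"
  yidx :: "nat \<Rightarrow> 'n set"
  cidx :: "nat \<Rightarrow> 'm set"
  fs :: "nat \<Rightarrow> real^'n \<Rightarrow> real^'p \<Rightarrow> real"
  cs :: "nat \<Rightarrow> real^'n \<Rightarrow> real^'p \<Rightarrow> real^'m"
  mu :: real

definition coord_space :: "'k::finite set \<Rightarrow> (real^'k) set" where
  "coord_space J = {z. \<forall>j. j \<notin> J \<longrightarrow> z $ j = 0}"

definition coord_proj :: "'k::finite set \<Rightarrow> real^'k \<Rightarrow> real^'k" where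
  "coord_proj J z = (\<chi> j. if j \<in> J then z $ j else 0)"

definition well_formed :: "('p::finite,'q::finite,'n::finite,'m::finite) two_stage \<Rightarrow> bool" where
  "well_formed P \<longleftrightarrow> mu P > 0 \<and>
     (\<forall>i\<in>{1..N P}. \<forall>y x. fs P i y x = fs P i (coord_proj (yidx P i) y) x
        \<and> cs P i y x = cs P i (coord_proj (yidx P i) y) x
        \<and> cs P i y x \<in> coord_space (cidx P i))"

text \<open>The variables of a smoothed subproblem, in the order (y, xt, s, lam, eta), where xt is the
  local copy of the first-stage variable.\<close>

type_synonym ('p,'n,'m) sub_vars = "(real^'n) \<times> (real^'p) \<times> (real^'m) \<times> (real^'m) \<times> (real^'p)"

definition var_space ::
    "('p::finite,'q::finite,'n::finite,'m::finite) two_stage \<Rightarrow> nat \<Rightarrow> ('p,'n,'m) sub_vars set" where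
  "var_space P i = coord_space (yidx P i) \<times> UNIV \<times> coord_space (cidx P i)
      \<times> coord_space (cidx P i) \<times> UNIV"

definition lagrangian :: "('p::finite,'q::finite,'n::finite,'m::finite) two_stage \<Rightarrow> nat \<Rightarrow>
    real^'p \<Rightarrow> ('p,'n,'m) sub_vars \<Rightarrow> real" where
  "lagrangian P i x = (\<lambda>(y, xt, s, lam, eta).
     fs P i y xt + (cs P i y xt + s) \<bullet> lam + (xt - x) \<bullet> eta)"

definition KKT_map :: "('p::finite,'q::finite,'n::finite,'m::finite) two_stage \<Rightarrow> nat \<Rightarrow>
    real^'p \<Rightarrow> ('p,'n,'m) sub_vars \<Rightarrow>
    (real^'n) \<times> (real^'p) \<times> (real^'m) \<times> (real^'m) \<times> (real^'p)" where
  "KKT_map P i x = (\<lambda>(y, xt, s, lam, eta).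
     (grad (\<lambda>y'. lagrangian P i x (y', xt, s, lam, eta)) y,
      grad (\<lambda>xt'. lagrangian P i x (y, xt', s, lam, eta)) xt,
      (\<chi> j. if j \<in> cidx P i then s $ j * lam $ j - mu P else 0),
      cs P i y xt + s,
      xt - x))"

text \<open>The set of pairs (x, v) of a parameter and a KKT point of the i-th smoothed subproblem.\<close>

definition KKT_set :: "('p::finite,'q::finite,'n::finite,'m::finite) two_stage \<Rightarrow> nat \<Rightarrow>
    ((real^'p) \<times> ('p,'n,'m) sub_vars) set" where
  "KKT_set P i = {(x, v). v \<in> var_space P i \<and> KKT_map P i x v = 0 \<and>
     (case v of (y, xt, s, lam, eta) \<Rightarrow> \<forall>j\<in>cidx P i. s $ j > 0 \<and> lam $ j > 0)}"

text \<open>KKT_map P i x maps var_space P i to itself, so its (square) Jacobian at a point of var_space P i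
  is the derivative restricted to that subspace.\<close>

definition KKT_jacobian_nonsingular ::
    "('p::finite,'q::finite,'n::finite,'m::finite) two_stage \<Rightarrow> nat \<Rightarrow>
    real^'p \<Rightarrow> ('p,'n,'m) sub_vars \<Rightarrow> bool" where
  "KKT_jacobian_nonsingular P i x v \<longleftrightarrow>
     (\<exists>D. (KKT_map P i x has_derivative D) (at v) \<and> bij_betw D (var_space P i) (var_space P i))"

definition nondegenerate :: "('p::finite,'q::finite,'n::finite,'m::finite) two_stage \<Rightarrow> nat \<Rightarrow>
    real^'p \<Rightarrow> ('p,'n,'m) sub_vars \<Rightarrow> bool" where
  "nondegenerate P i x v \<longleftrightarrow> (x, v) \<in> KKT_set P i \<and> KKT_jacobian_nonsingular P i x v"


section \<open>Solution maps\<close>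

definition solution_map :: "('p::finite,'q::finite,'n::finite,'m::finite) two_stage \<Rightarrow> nat \<Rightarrow>
    (real^'p) set \<Rightarrow> (real^'p \<Rightarrow> ('p,'n,'m) sub_vars) \<Rightarrow> bool" where
  "solution_map P i U w \<longleftrightarrow> continuous_on U w \<and> (\<forall>x\<in>U. (x, w x) \<in> KKT_set P i)"

definition C1_solution_map_at :: "('p::finite,'q::finite,'n::finite,'m::finite) two_stage \<Rightarrow> nat \<Rightarrow>
    real^'p \<Rightarrow> ('p,'n,'m) sub_vars \<Rightarrow> real \<Rightarrow> (real^'p \<Rightarrow> ('p,'n,'m) sub_vars) \<Rightarrow> bool" where
  "C1_solution_map_at P i xb vb r w \<longleftrightarrow>
     solution_map P i (ball xb r) w \<and> C1_on (ball xb r) w \<and> w xb = vb"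

text \<open>The properties of the radii r1, r2 attached to a nondegenerate point (xb, vb); suitable radii
  exist by the implicit function theorem.\<close>

definition admissible_radii :: "('p::finite,'q::finite,'n::finite,'m::finite) two_stage \<Rightarrow> nat \<Rightarrow>
    real^'p \<Rightarrow> ('p,'n,'m) sub_vars \<Rightarrow> real \<Rightarrow> real \<Rightarrow> bool" where
  "admissible_radii P i xb vb r1 r2 \<longleftrightarrow> 0 < r2 \<and> r2 \<le> r1 \<and>
     (\<exists>w. C1_solution_map_at P i xb vb r1 w
        \<and> (\<forall>w'. C1_solution_map_at P i xb vb r1 w' \<longrightarrow> (\<forall>x\<in>ball xb r1. w' x = w x))
        \<and> {(x, v). v \<in> var_space P i \<and> KKT_map P i x v = 0} \<inter> ball (xb, vb) r2
            = {(x, v). x \<in> ball xb r1 \<and> v = w x} \<inter> ball (xb, vb) r2)"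

text \<open>For an admissible radius r the choice is unique on ball xb r.\<close>

definition local_solution_map :: "('p::finite,'q::finite,'n::finite,'m::finite) two_stage \<Rightarrow> nat \<Rightarrow>
    real^'p \<Rightarrow> ('p,'n,'m) sub_vars \<Rightarrow> real \<Rightarrow> real^'p \<Rightarrow> ('p,'n,'m) sub_vars" where
  "local_solution_map P i xb vb r = (SOME w. C1_solution_map_at P i xb vb r w)"


section \<open>Second-stage values, merit function and model\<close>

datatype smoothing = Solution_Smoothing | Objective_Smoothing

definition fhat :: "smoothing \<Rightarrow> ('p::finite,'q::finite,'n::finite,'m::finite) two_stage \<Rightarrow> nat \<Rightarrow>
    real^'p \<Rightarrow> ('p,'n,'m) sub_vars \<Rightarrow> real" where
  "fhat sm P i x = (\<lambda>(y, xt, s, lam, eta). case sm of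
       Solution_Smoothing \<Rightarrow> fs P i y x
     | Objective_Smoothing \<Rightarrow> fs P i y x - mu P * (\<Sum>j\<in>cidx P i. ln (s $ j)))"

definition local_fhat :: "smoothing \<Rightarrow> ('p::finite,'q::finite,'n::finite,'m::finite) two_stage \<Rightarrow>
    (nat \<Rightarrow> real^'p \<Rightarrow> ('p,'n,'m) sub_vars \<Rightarrow> real) \<Rightarrow> nat \<Rightarrow>
    real^'p \<Rightarrow> ('p,'n,'m) sub_vars \<Rightarrow> real^'p \<Rightarrow> real" where
  "local_fhat sm P r1 i xb vb x = fhat sm P i x (local_solution_map P i xb vb (r1 i xb vb) x)"

text \<open>The requirement on the gradient g returned by the solver together with v at x.  The local
  function exists only if (x, v) is nondegenerate; otherwise g is unconstrained for solution smoothing.\<close>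

definition correct_gradient :: "smoothing \<Rightarrow>
    ('p::finite,'q::finite,'n::finite,'m::finite) two_stage \<Rightarrow>
    (nat \<Rightarrow> real^'p \<Rightarrow> ('p,'n,'m) sub_vars \<Rightarrow> real) \<Rightarrow> nat \<Rightarrow>
    real^'p \<Rightarrow> ('p,'n,'m) sub_vars \<Rightarrow> real^'p \<Rightarrow> bool" where
  "correct_gradient sm P r1 i x v g \<longleftrightarrow>
     (nondegenerate P i x v \<longrightarrow> GDERIV (local_fhat sm P r1 i x v) x :> g) \<and>
     (sm = Objective_Smoothing \<longrightarrow> (case v of (y, xt, s, lam, eta) \<Rightarrow> g = - eta))"

definition merit :: "smoothing \<Rightarrow> ('p::finite,'q::finite,'n::finite,'m::finite) two_stage \<Rightarrow> real \<Rightarrow>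
    real^'p \<Rightarrow> (nat \<Rightarrow> ('p,'n,'m) sub_vars) \<Rightarrow> real" where
  "merit sm P \<pi> x v = f0 P x + (\<Sum>i = 1..N P. fhat sm P i x (v i)) + \<pi> * norm1 (pos_part (c0 P x))"

definition local_merit :: "smoothing \<Rightarrow> ('p::finite,'q::finite,'n::finite,'m::finite) two_stage \<Rightarrow>
    (nat \<Rightarrow> real^'p \<Rightarrow> ('p,'n,'m) sub_vars \<Rightarrow> real) \<Rightarrow> real \<Rightarrow>
    real^'p \<Rightarrow> (nat \<Rightarrow> ('p,'n,'m) sub_vars) \<Rightarrow> real^'p \<Rightarrow> real" where
  "local_merit sm P r1 \<pi> xb vb x =
     f0 P x + (\<Sum>i = 1..N P. local_fhat sm P r1 i xb (vb i) x) + \<pi> * norm1 (pos_part (c0 P x))"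

text \<open>Here v i and g i are the subproblem solution and the gradient on which the value and the gradient
  of the i-th second-stage function at x are based.\<close>

definition model :: "smoothing \<Rightarrow> ('p::finite,'q::finite,'n::finite,'m::finite) two_stage \<Rightarrow> real \<Rightarrow>
    real^'p \<Rightarrow> (nat \<Rightarrow> ('p,'n,'m) sub_vars) \<Rightarrow> (nat \<Rightarrow> real^'p) \<Rightarrow> real^'p^'p \<Rightarrow> real^'p \<Rightarrow> real" where
  "model sm P \<pi> x v g H p =
     f0 P x + (\<Sum>i = 1..N P. fhat sm P i x (v i))
     + (grad (f0 P) x + (\<Sum>i = 1..N P. g i)) \<bullet> p + 1/2 * (p \<bullet> (H *v p))
     + \<pi> * norm1 (pos_part (c0 P x + jacobian (c0 P) (at x) *v p))"

text \<open>The one-sided directional derivatives are required to exist, so that no unspecified value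
  of a limit operator enters.\<close>

definition subdifferential :: "('a::real_inner \<Rightarrow> real) \<Rightarrow> 'a \<Rightarrow> 'a set" where
  "subdifferential \<phi> x = {g. \<forall>d. \<exists>l.
     ((\<lambda>t. (\<phi> (x + t *\<^sub>R d) - \<phi> x) / t) \<longlongrightarrow> l) (at_right (0::real)) \<and> g \<bullet> d \<le> l}"

definition stationary_point :: "('a::real_inner \<Rightarrow> real) \<Rightarrow> 'a \<Rightarrow> bool" where
  "stationary_point \<phi> x \<longleftrightarrow> 0 \<in> subdifferential \<phi> x"


section \<open>The two-stage trust-region algorithm\<close>

record tr_params =
  Delta_max :: real
  penalty :: real
  eta1 :: real
  eta2 :: real
  gamma1 :: real
  gamma2 :: real
  gamma3 :: real

definition valid_params :: "tr_params \<Rightarrow> bool" where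
  "valid_params T \<longleftrightarrow> 0 < Delta_max T \<and> 0 < penalty T
     \<and> 0 < eta1 T \<and> eta1 T \<le> eta2 T \<and> eta2 T < 1
     \<and> 0 < 1 / gamma3 T \<and> 1 / gamma3 T \<le> gamma1 T \<and> gamma1 T \<le> gamma2 T
     \<and> gamma2 T < 1 \<and> 1 < gamma3 T"

text \<open>solver i x v0 is the point returned by the i-th subproblem solver for the input x and the
  starting point v0.\<close>

type_synonym ('p,'n,'m) solver =
  "nat \<Rightarrow> real^'p \<Rightarrow> ('p,'n,'m) sub_vars \<Rightarrow> ('p,'n,'m) sub_vars"

text \<open>The data of a run; itv R k i is the subproblem solution and itg R k i the gradient
  of the i-th second-stage function held at iteration k, and start R i is the starting point for
  the first call of the i-th solver.\<close>

record ('p::finite,'n::finite,'m::finite) tr_run =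
  start :: "nat \<Rightarrow> ('p,'n,'m) sub_vars"
  itx :: "nat \<Rightarrow> real^'p"
  itv :: "nat \<Rightarrow> nat \<Rightarrow> ('p,'n,'m) sub_vars"
  itg :: "nat \<Rightarrow> nat \<Rightarrow> real^'p"
  itH :: "nat \<Rightarrow> real^'p^'p"
  itp :: "nat \<Rightarrow> real^'p"
  itD :: "nat \<Rightarrow> real"

definition trial_v :: "('p::finite,'n::finite,'m::finite) solver \<Rightarrow> ('p,'n,'m) tr_run \<Rightarrow>
    nat \<Rightarrow> nat \<Rightarrow> ('p,'n,'m) sub_vars" where
  "trial_v solver R k i = solver i (itx R k + itp R k) (itv R k i)"

definition run_model :: "smoothing \<Rightarrow> ('p::finite,'q::finite,'n::finite,'m::finite) two_stage \<Rightarrow>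
    tr_params \<Rightarrow> ('p,'n,'m) tr_run \<Rightarrow> nat \<Rightarrow> real^'p \<Rightarrow> real" where
  "run_model sm P T R k p = model sm P (penalty T) (itx R k) (itv R k) (itg R k) (itH R k) p"

text \<open>A quotient with vanishing denominator is 0, so a step without predicted reduction is rejected.\<close>

definition rho :: "smoothing \<Rightarrow> ('p::finite,'q::finite,'n::finite,'m::finite) two_stage \<Rightarrow>
    tr_params \<Rightarrow> ('p,'n,'m) solver \<Rightarrow> ('p,'n,'m) tr_run \<Rightarrow> nat \<Rightarrow> real" where
  "rho sm P T solver R k =
     (merit sm P (penalty T) (itx R k) (itv R k)
        - merit sm P (penalty T) (itx R k + itp R k) (trial_v solver R k))
     / (run_model sm P T R k 0 - run_model sm P T R k (itp R k))"

text \<open>An infinite run, i.e. one in which the termination test never succeeds.\<close>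

definition trust_region_run :: "smoothing \<Rightarrow>
    ('p::finite,'q::finite,'n::finite,'m::finite) two_stage \<Rightarrow>
    (nat \<Rightarrow> real^'p \<Rightarrow> ('p,'n,'m) sub_vars \<Rightarrow> real) \<Rightarrow>
    tr_params \<Rightarrow> ('p,'n,'m) solver \<Rightarrow> ('p,'n,'m) tr_run \<Rightarrow> bool" where
  "trust_region_run sm P r1 T solver R \<longleftrightarrow>
     0 < itD R 0 \<and> itD R 0 \<le> Delta_max T
   \<and> (\<forall>i\<in>{1..N P}. start R i \<in> var_space P i \<and> itv R 0 i = solver i (itx R 0) (start R i))
   \<and> (\<forall>k.
        (\<forall>i\<in>{1..N P}. correct_gradient sm P r1 i (itx R k) (itv R k i) (itg R k i))
      \<and> transpose (itH R k) = itH R k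
      \<and> norm (itp R k) \<le> itD R k
      \<and> (\<forall>q. norm q \<le> itD R k \<longrightarrow> run_model sm P T R k (itp R k) \<le> run_model sm P T R k q)
      \<and> itp R k \<noteq> 0
      \<and> (let \<rho> = rho sm P T solver R k in
          (if \<rho> \<ge> eta1 T
           then itx R (Suc k) = itx R k + itp R k
              \<and> (\<forall>i\<in>{1..N P}. itv R (Suc k) i = trial_v solver R k i)
           else itx R (Suc k) = itx R k
              \<and> (\<forall>i\<in>{1..N P}. itv R (Suc k) i = itv R k i))
        \<and> (if \<rho> \<ge> eta2 T
           then itD R (Suc k) \<in> {min (gamma3 T * itD R k) (Delta_max T) .. Delta_max T}
           else if \<rho> \<ge> eta1 T
           then itD R (Suc k) \<in> {gamma2 T * itD R k .. itD R k}
           else itD R (Suc k) \<in> {gamma1 T * itD R k .. gamma2 T * itD R k})))"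

definition limit_point_of_run :: "('p::finite,'q::finite,'n::finite,'m::finite) two_stage \<Rightarrow>
    ('p,'n,'m) tr_run \<Rightarrow> real^'p \<Rightarrow> (nat \<Rightarrow> ('p,'n,'m) sub_vars) \<Rightarrow> bool" where
  "limit_point_of_run P R xinf vinf \<longleftrightarrow> (\<exists>r. strict_mono (r :: nat \<Rightarrow> nat)
     \<and> (\<lambda>n. itx R (r n)) \<longlonglongrightarrow> xinf
     \<and> (\<forall>i\<in>{1..N P}. (\<lambda>n. itv R (r n) i) \<longlonglongrightarrow> vinf i))"


section \<open>Assumptions\<close>

definition subproblem_feasible :: "('p::finite,'q::finite,'n::finite,'m::finite) two_stage \<Rightarrow>
    nat \<Rightarrow> real^'p \<Rightarrow> bool" where
  "subproblem_feasible P i x \<longleftrightarrow>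
     (\<exists>y\<in>coord_space (yidx P i). \<forall>j\<in>cidx P i. cs P i y x $ j \<le> 0)"

text \<open>The points sent to the subproblems are the initial point and all trial points.\<close>

definition feasibility_assumption :: "('p::finite,'q::finite,'n::finite,'m::finite) two_stage \<Rightarrow>
    ('p,'n,'m) solver \<Rightarrow> ('p,'n,'m) tr_run \<Rightarrow> bool" where
  "feasibility_assumption P solver R \<longleftrightarrow> (\<forall>i\<in>{1..N P}.
      subproblem_feasible P i (itx R 0)
    \<and> (itx R 0, solver i (itx R 0) (start R i)) \<in> KKT_set P i
    \<and> (\<forall>k. subproblem_feasible P i (itx R k + itp R k)
         \<and> (itx R k + itp R k, trial_v solver R k i) \<in> KKT_set P i))"

definition regularity_assumption :: "smoothing \<Rightarrow>
    ('p::finite,'q::finite,'n::finite,'m::finite) two_stage \<Rightarrow> bool" where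
  "regularity_assumption sm P \<longleftrightarrow> C1_lip (f0 P) \<and> C1_lip (c0 P) \<and>
     (\<forall>i\<in>{1..N P}. case sm of
        Objective_Smoothing \<Rightarrow>
          C2_lip (\<lambda>(y, x). fs P i y x) \<and> C2_lip (\<lambda>(y, x). cs P i y x)
      | Solution_Smoothing \<Rightarrow>
          C3 (\<lambda>(y, x). fs P i y x) \<and> C3 (\<lambda>(y, x). cs P i y x))"

definition consistent_output_assumption ::
    "('p::finite,'q::finite,'n::finite,'m::finite) two_stage \<Rightarrow>
    (nat \<Rightarrow> real^'p \<Rightarrow> ('p,'n,'m) sub_vars \<Rightarrow> real) \<Rightarrow>
    ('p,'n,'m) solver \<Rightarrow> ('p,'n,'m) tr_run \<Rightarrow> bool" where
  "consistent_output_assumption P r2 solver R \<longleftrightarrow>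
     (\<forall>i\<in>{1..N P}. \<forall>xb vb. nondegenerate P i xb vb \<longrightarrow>
        (\<exists>r3>0. \<forall>k. (itx R k, itv R k i) \<in> KKT_set P i \<inter> ball (xb, vb) r3 \<longrightarrow>
           (\<forall>p. norm p \<le> r3 \<longrightarrow>
              (itx R k + p, solver i (itx R k + p) (itv R k i)) \<in> ball (xb, vb) (r2 i xb vb))))"

end

theory Submission
  imports Defs
begin

text \<open>
  The assumptions say that the algorithm never really sees a two-stage problem near the limit
  point \<open>(xinf, vinf)\<close>: it runs an ordinary trust-region method on one fixed function
  \<open>\<psi> + \<pi> * l1_violation \<circ> c0\<close>, with \<open>\<psi>\<close> of class C1.  The reasons are as follows.

  \<^item> The KKT set is closed, because complementarity \<open>s * lam = mu > 0\<close> keeps the limit strictly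
    positive; so the limit point lies on it and is nondegenerate (\<open>KKT_set_closed_under_limits\<close>).
    Nondegeneracy is an open condition since the KKT map is C1 (\<open>nondegenerate_open\<close>).

  \<^item> Near a nondegenerate point the KKT set is the graph of one C1 map \<open>w\<close>.  Hence iterates close to
    the limit have \<open>v = w x\<close>, the consistent-output assumption forces the same for trial points of
    short steps, and the gradient returned by the solver is that of the local function of
    the limit point, because two local solution maps through the same point of the graph
    agree nearby (\<open>gradient_independent_of_reference_point\<close>, \<open>subproblem_data_near_limit\<close>).

  Suppose the limit point were not stationary.  Then the first-order model there decreases along
  some direction; by convexity of the penalty and continuity of the derivatives the predicted
  reduction is at least \<open>\<kappa> * min \<delta> \<Delta>\<close> uniformly for all iterates near the limit, whereas the
  model error is \<open>o(\<Delta>)\<close>, so that steps with small radius are very successful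
  (\<open>nonstationary_model_estimates\<close>).

  A limit point is visited only along a subsequence, and the radius may be tiny on arrival.  The
  decisive observation (\<open>trust_region_sequence_no_uniform_decrease\<close>) is that the merit values are
  monotone and converge along the whole sequence, so that from some visit on no accepted step near
  the limit can have a radius above a fixed threshold.  Accepted steps are then
  shorter than a multiple of the merit decrease, so the total length travelled is small and
  the iterates stay near the limit and on the graph of \<open>w\<close> forever.  But there small
  radii grow geometrically, while large radii cause rejections only and shrink
  geometrically without ever falling below the threshold: a contradiction either way.
\<close>

section \<open>A calculus of continuously differentiable maps\<close>

text \<open>In finite dimensions continuity of the derivative may be checked direction by direction.\<close>

lemma C1_on_iff:
  fixes f :: "'a::euclidean_space \<Rightarrow> 'b::real_normed_vector"
  shows "C1_on U f \<longleftrightarrow> (\<exists>D. (\<forall>x\<in>U. (f has_derivative D x) (at x)) \<and>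
           (\<forall>d. continuous_on U (\<lambda>x. D x d)))"
proof
  assume "C1_on U f"
  then obtain f' where f': "is_derivative_on U f f'" "continuous_on U f'"
    unfolding C1_on_def by blast
  then show "\<exists>D. (\<forall>x\<in>U. (f has_derivative D x) (at x)) \<and>
           (\<forall>d. continuous_on U (\<lambda>x. D x d))"
    by (intro exI[of _ "\<lambda>x. blinfun_apply (f' x)"])
       (auto simp: is_derivative_on_def intro!: continuous_intros)
next
  assume "\<exists>D. (\<forall>x\<in>U. (f has_derivative D x) (at x)) \<and>
           (\<forall>d. continuous_on U (\<lambda>x. D x d))"
  then obtain D where D: "\<And>x. x \<in> U \<Longrightarrow> (f has_derivative D x) (at x)"
    "\<And>d. continuous_on U (\<lambda>x. D x d)" by blast
  define f' where "f' x = Blinfun (D x)" for x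
  have app: "blinfun_apply (f' x) = D x" if "x \<in> U" for x
    unfolding f'_def using D(1)[OF that]
    by (simp add: bounded_linear_Blinfun_apply has_derivative_bounded_linear)
  have "continuous_on U f'"
  proof (rule continuous_on_blinfun_componentwise)
    fix i :: 'a assume "i \<in> Basis"
    show "continuous_on U (\<lambda>x. f' x i)"
      using D(2)[of i] by (rule continuous_on_eq) (simp add: app)
  qed
  moreover have "is_derivative_on U f f'"
    using D(1) by (simp add: is_derivative_on_def app)
  ultimately show "C1_on U f" unfolding C1_on_def by blast
qed

lemma C1_onE:
  fixes f :: "'a::euclidean_space \<Rightarrow> 'b::real_normed_vector"
  assumes "C1_on U f"
  obtains D where "\<And>x. x \<in> U \<Longrightarrow> (f has_derivative D x) (at x)"
    "\<And>d. continuous_on U (\<lambda>x. D x d)"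
  using assms unfolding C1_on_iff by blast

lemma C1_onI:
  fixes f :: "'a::euclidean_space \<Rightarrow> 'b::real_normed_vector"
  assumes "\<And>x. x \<in> U \<Longrightarrow> (f has_derivative D x) (at x)"
    "\<And>d. continuous_on U (\<lambda>x. D x d)"
  shows "C1_on U f"
  using assms unfolding C1_on_iff by blast

lemma C1_on_continuous:
  assumes "C1_on U f"
  shows "continuous_on U f"
  using assms unfolding C1_on_def is_derivative_on_def
  by (meson continuous_at_imp_continuous_on has_derivative_continuous)

lemma C1_on_subset: "C1_on U f \<Longrightarrow> V \<subseteq> U \<Longrightarrow> C1_on V f"
  unfolding C1_on_def is_derivative_on_def by (meson continuous_on_subset subsetD)

lemma C1_on_const: "C1_on U (\<lambda>x::'a::euclidean_space. c :: 'b::real_normed_vector)"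
  by (rule C1_onI[where D = "\<lambda>x d. 0"]) auto

lemma C1_on_bounded_linear:
  assumes "bounded_linear (L :: 'a::euclidean_space \<Rightarrow> 'b::real_normed_vector)"
  shows "C1_on U L"
  by (rule C1_onI[where D = "\<lambda>x. L"])
     (auto intro: bounded_linear_imp_has_derivative assms)

lemma C1_on_add:
  fixes f g :: "'a::euclidean_space \<Rightarrow> 'b::real_normed_vector"
  assumes "C1_on U f" "C1_on U g"
  shows "C1_on U (\<lambda>x. f x + g x)"
proof -
  obtain D where D: "\<And>x. x \<in> U \<Longrightarrow> (f has_derivative D x) (at x)"
    "\<And>d. continuous_on U (\<lambda>x. D x d)" using assms(1) by (rule C1_onE) blast
  obtain E where E: "\<And>x. x \<in> U \<Longrightarrow> (g has_derivative E x) (at x)"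
    "\<And>d. continuous_on U (\<lambda>x. E x d)" using assms(2) by (rule C1_onE) blast
  show ?thesis
    by (rule C1_onI[where D = "\<lambda>x d. D x d + E x d"])
       (auto intro!: has_derivative_add D E continuous_on_add)
qed

lemma C1_on_bilinear:
  fixes f :: "'a::euclidean_space \<Rightarrow> 'b::real_normed_vector"
    and g :: "'a::euclidean_space \<Rightarrow> 'c::real_normed_vector"
    and B :: "'b \<Rightarrow> 'c \<Rightarrow> 'd::real_normed_vector"
  assumes B: "bounded_bilinear B" and f: "C1_on U f" and g: "C1_on U g"
  shows "C1_on U (\<lambda>x. B (f x) (g x))"
proof -
  obtain D where D: "\<And>x. x \<in> U \<Longrightarrow> (f has_derivative D x) (at x)"
    "\<And>d. continuous_on U (\<lambda>x. D x d)" using f by (rule C1_onE) blast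
  obtain E where E: "\<And>x. x \<in> U \<Longrightarrow> (g has_derivative E x) (at x)"
    "\<And>d. continuous_on U (\<lambda>x. E x d)" using g by (rule C1_onE) blast
  show ?thesis
    by (rule C1_onI[where D = "\<lambda>x d. B (f x) (E x d) + B (D x d) (g x)"])
       (auto intro!: bounded_bilinear.FDERIV[OF B] D E continuous_on_add
         bounded_bilinear.continuous_on[OF B] C1_on_continuous[OF f] C1_on_continuous[OF g])
qed

lemma C1_on_compose:
  fixes f :: "'a::euclidean_space \<Rightarrow> 'b::real_normed_vector"
    and g :: "'b \<Rightarrow> 'c::real_normed_vector"
  assumes f: "C1_on U f" and g: "C1_on V g" and sub: "\<And>x. x \<in> U \<Longrightarrow> f x \<in> V"
  shows "C1_on U (\<lambda>x. g (f x))"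
proof -
  obtain D where D: "\<And>x. x \<in> U \<Longrightarrow> (f has_derivative D x) (at x)"
    "\<And>d. continuous_on U (\<lambda>x. D x d)" using f by (rule C1_onE) blast
  obtain g' where g': "is_derivative_on V g g'" "continuous_on V g'"
    using g unfolding C1_on_def by blast
  show ?thesis
  proof (rule C1_onI[where D = "\<lambda>x d. g' (f x) (D x d)"])
    fix x assume "x \<in> U"
    then have "(g has_derivative blinfun_apply (g' (f x))) (at (f x))"
      using g'(1) sub by (auto simp: is_derivative_on_def)
    from has_derivative_compose[OF D(1)[OF \<open>x \<in> U\<close>] this]
    show "((\<lambda>x. g (f x)) has_derivative (\<lambda>d. g' (f x) (D x d))) (at x)" .
  next
    fix d
    have "continuous_on U (\<lambda>x. g' (f x))"
      using continuous_on_compose2[OF g'(2) C1_on_continuous[OF f]] sub by blast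
    then show "continuous_on U (\<lambda>x. g' (f x) (D x d))"
      by (intro continuous_intros D(2))
  qed
qed

lemma C1_on_linear_compose:
  fixes f :: "'a::euclidean_space \<Rightarrow> 'b::euclidean_space"
  assumes "bounded_linear L" "C1_on U f"
  shows "C1_on U (\<lambda>x. L (f x))"
  by (rule C1_on_compose[OF assms(2) C1_on_bounded_linear[OF assms(1), of UNIV]]) simp

lemma C1_on_diff:
  fixes f g :: "'a::euclidean_space \<Rightarrow> 'b::euclidean_space"
  assumes "C1_on U f" "C1_on U g"
  shows "C1_on U (\<lambda>x. f x - g x)"
  using C1_on_add[OF assms(1) C1_on_linear_compose[OF bounded_linear_minus[OF bounded_linear_ident] assms(2)]]
  by simp

lemma C1_on_Pair:
  fixes f :: "'a::euclidean_space \<Rightarrow> 'b::euclidean_space"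
    and g :: "'a::euclidean_space \<Rightarrow> 'c::euclidean_space"
  assumes "C1_on U f" "C1_on U g"
  shows "C1_on U (\<lambda>x. (f x, g x))"
proof -
  have "C1_on U (\<lambda>x. (f x, 0::'c) + (0::'b, g x))"
    by (intro C1_on_add C1_on_linear_compose[OF _ assms(1)] C1_on_linear_compose[OF _ assms(2)]
        bounded_linear_Pair bounded_linear_ident bounded_linear_zero)
  then show ?thesis by simp
qed

lemma C1_on_sum:
  fixes f :: "'i \<Rightarrow> 'a::euclidean_space \<Rightarrow> 'b::real_normed_vector"
  assumes "\<And>i. i \<in> I \<Longrightarrow> C1_on U (f i)"
  shows "C1_on U (\<lambda>x. \<Sum>i\<in>I. f i x)"
  using assms
  by (induction I rule: infinite_finite_induct) (auto intro: C1_on_const C1_on_add)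

lemma C1_on_ln: "C1_on {0<..} (ln :: real \<Rightarrow> real)"
  by (rule C1_onI[where D = "\<lambda>x d. d / x"])
     (auto intro!: derivative_eq_intros continuous_intros simp: divide_inverse)

lemma C1_on_GDERIV:
  fixes f :: "'a::euclidean_space \<Rightarrow> real"
  assumes "C1_on U f"
  obtains g where "\<And>x. x \<in> U \<Longrightarrow> GDERIV f x :> g x" "continuous_on U g"
proof -
  obtain D where D: "\<And>x. x \<in> U \<Longrightarrow> (f has_derivative D x) (at x)"
    "\<And>d. continuous_on U (\<lambda>x. D x d)" using assms by (rule C1_onE) blast
  let ?g = "\<lambda>x. \<Sum>b\<in>Basis. D x b *\<^sub>R b"
  have "D x d = d \<bullet> ?g x" if "x \<in> U" for x d
  proof -
    have "linear (D x)" using D(1)[OF that] by (rule has_derivative_linear)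
    have "d \<bullet> ?g x = (\<Sum>b\<in>Basis. (d \<bullet> b) * D x b)"
      by (simp add: inner_sum_right mult.commute)
    also have "\<dots> = D x (\<Sum>b\<in>Basis. (d \<bullet> b) *\<^sub>R b)"
      by (simp add: linear_sum[OF \<open>linear (D x)\<close>] linear_scale[OF \<open>linear (D x)\<close>])
    finally show ?thesis by (simp add: euclidean_representation)
  qed
  then have "GDERIV f x :> ?g x" if "x \<in> U" for x
    using D(1)[OF that] that unfolding gderiv_def by (metis (no_types, lifting) ext)
  moreover have "continuous_on U ?g" by (intro continuous_intros D(2))
  ultimately show ?thesis by (rule that)
qed

text \<open>Continuity of the derivative makes the first-order expansion uniform in the base point.\<close>

lemma C1_on_uniform_expansion:
  fixes f :: "'a::euclidean_space \<Rightarrow> 'b::real_normed_vector"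
  assumes "C1_on (ball a r) f" "0 < r" "0 < e"
    and D: "\<And>x. x \<in> ball a r \<Longrightarrow> (f has_derivative D x) (at x)"
  obtains s where "0 < s" "s \<le> r"
    "\<And>x y. x \<in> ball a s \<Longrightarrow> y \<in> ball a s \<Longrightarrow> norm (f y - f x - D x (y - x)) \<le> e * norm (y - x)"
proof -
  obtain f' where f': "is_derivative_on (ball a r) f f'" "continuous_on (ball a r) f'"
    using assms(1) unfolding C1_on_def by blast
  have eq: "D x = blinfun_apply (f' x)" if "x \<in> ball a r" for x
    using f'(1) D[OF that] that unfolding is_derivative_on_def
    by (metis has_derivative_unique)
  have "continuous (at a) f'"
    using f'(2) \<open>0 < r\<close> by (simp add: continuous_on_eq_continuous_at)
  then obtain t where t: "0 < t" "\<And>x. dist x a < t \<Longrightarrow> dist (f' x) (f' a) < e / 2"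
    using \<open>0 < e\<close> unfolding continuous_at_eps_delta by (metis half_gt_zero)
  show ?thesis
  proof (rule that[of "min r t"])
    show "0 < min r t" "min r t \<le> r" using \<open>0 < r\<close> t(1) by auto
    fix x y assume xy: "x \<in> ball a (min r t)" "y \<in> ball a (min r t)"
    have "norm (f y - f x - blinfun_apply (f' x) (y - x)) \<le> norm (y - x) * e"
    proof (rule differentiable_bound_linearization[where S = "ball a (min r t)" and f' = "\<lambda>z. blinfun_apply (f' z)"])
      fix u :: real assume "u \<in> {0..1}"
      then have "(1 - u) *\<^sub>R x + u *\<^sub>R y \<in> ball a (min r t)"
        using xy convex_ball[of a "min r t"] by (intro convexD) auto
      moreover have "(1 - u) *\<^sub>R x + u *\<^sub>R y = x + u *\<^sub>R (y - x)" by (simp add: algebra_simps)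
      ultimately show "x + u *\<^sub>R (y - x) \<in> ball a (min r t)" by simp
    next
      fix z assume "z \<in> ball a (min r t)"
      then show "(f has_derivative blinfun_apply (f' z)) (at z within ball a (min r t))"
        using f'(1) unfolding is_derivative_on_def
        by (auto intro: has_derivative_at_withinI)
    next
      fix z assume z: "z \<in> ball a (min r t)"
      have "dist (f' z) (f' x) \<le> dist (f' z) (f' a) + dist (f' x) (f' a)"
        by (rule dist_triangle2)
      also have "\<dots> \<le> e"
        using t(2)[of z] t(2)[of x] z xy by (auto simp: dist_commute)
      finally have "norm (f' z - f' x) \<le> e" by (simp add: dist_norm)
      moreover have "blinfun_apply (f' z) - blinfun_apply (f' x) = blinfun_apply (f' z - f' x)"
        by (simp add: fun_eq_iff blinfun.diff_left)
      ultimately show "onorm (blinfun_apply (f' z) - blinfun_apply (f' x)) \<le> e"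
        by (simp add: norm_blinfun.rep_eq)
    qed (use xy in auto)
    then show "norm (f y - f x - D x (y - x)) \<le> e * norm (y - x)"
      using xy(1) by (simp add: eq mult.commute)
  qed
qed


section \<open>The exact penalty function and its one-sided derivatives\<close>

definition l1_violation :: "real^'q \<Rightarrow> real" where
  "l1_violation z = norm1 (pos_part z)"

lemma l1_violation_eq: "l1_violation z = (\<Sum>j\<in>UNIV. max 0 (z $ j))"
  by (simp add: l1_violation_def norm1_def pos_part_def)

lemma l1_violation_lipschitz:
  "\<bar>l1_violation a - l1_violation (b :: real^'q)\<bar> \<le> real CARD('q) * norm (a - b)"
proof -
  have "\<bar>l1_violation a - l1_violation b\<bar> = \<bar>\<Sum>j\<in>UNIV. max 0 (a $ j) - max 0 (b $ j)\<bar>"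
    by (simp add: l1_violation_eq sum_subtractf)
  also have "\<dots> \<le> (\<Sum>j\<in>UNIV. \<bar>max 0 (a $ j) - max 0 (b $ j)\<bar>)" by (rule sum_abs)
  also have "\<dots> \<le> (\<Sum>j\<in>(UNIV::'q set). norm (a - b))"
  proof (rule sum_mono)
    fix j
    have "\<bar>max 0 (a $ j) - max 0 (b $ j)\<bar> \<le> \<bar>(a - b) $ j\<bar>" by (simp add: max_def)
    also have "\<dots> \<le> norm (a - b)" by (rule component_le_norm_cart)
    finally show "\<bar>max 0 (a $ j) - max 0 (b $ j)\<bar> \<le> norm (a - b)" .
  qed
  finally show ?thesis by simp
qed

lemma l1_violation_continuous: "continuous_on UNIV (l1_violation :: real^'q \<Rightarrow> real)"
  unfolding l1_violation_eq[abs_def] by (intro continuous_intros)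

lemma l1_violation_convex:
  assumes "0 \<le> t" "t \<le> 1"
  shows "l1_violation (z + t *\<^sub>R d) \<le> (1 - t) * l1_violation z + t * l1_violation (z + d)"
proof -
  have "max 0 ((z + t *\<^sub>R d) $ j) \<le> (1 - t) * max 0 (z $ j) + t * max 0 ((z + d) $ j)" for j
  proof -
    have "(z + t *\<^sub>R d) $ j = (1 - t) * (z $ j) + t * ((z + d) $ j)" by (simp add: algebra_simps)
    also have "\<dots> \<le> (1 - t) * max 0 (z $ j) + t * max 0 ((z + d) $ j)"
      using assms by (intro add_mono mult_left_mono) auto
    finally show ?thesis using assms by simp
  qed
  then show ?thesis
    unfolding l1_violation_eq sum_distrib_left sum.distrib[symmetric] by (intro sum_mono)
qed

text \<open>Only \<open>u 0 = 0\<close> is delicate: there the positive part commutes with the division by \<open>t > 0\<close>, whence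
  the limit is the positive part of the derivative.\<close>

lemma max_zero_one_sided_derivative:
  fixes u :: "real \<Rightarrow> real"
  assumes u: "(u has_real_derivative e) (at 0)"
  shows "\<exists>l. ((\<lambda>t. (max 0 (u t) - max 0 (u 0)) / t) \<longlongrightarrow> l) (at_right 0)"
proof -
  have q: "((\<lambda>t. (u t - u 0) / t) \<longlongrightarrow> e) (at_right 0)"
    using u unfolding has_field_derivative_iff by (simp add: filterlim_at_split)
  have "(u \<longlongrightarrow> u 0) (at 0)"
    using DERIV_isCont[OF u] by (simp add: isCont_def)
  then have c: "(u \<longlongrightarrow> u 0) (at_right 0)" by (simp add: filterlim_at_split)
  consider "u 0 > 0" | "u 0 < 0" | "u 0 = 0" by linarith
  then show ?thesis
  proof cases
    case 1
    have "eventually (\<lambda>t. u t > 0) (at_right 0)" using order_tendstoD(1)[OF c] 1 by blast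
    then have "eventually (\<lambda>t. (u t - u 0) / t = (max 0 (u t) - max 0 (u 0)) / t) (at_right 0)"
      by (rule eventually_mono) (use 1 in simp)
    from Lim_transform_eventually[OF q this] show ?thesis by blast
  next
    case 2
    have "eventually (\<lambda>t. u t < 0) (at_right 0)" using order_tendstoD(2)[OF c] 2 by blast
    then have "eventually (\<lambda>t. 0 = (max 0 (u t) - max 0 (u 0)) / t) (at_right 0)"
      by (rule eventually_mono) (use 2 in simp)
    from Lim_transform_eventually[OF tendsto_const this] show ?thesis by blast
  next
    case 3
    have "((\<lambda>t. max 0 ((u t - u 0) / t)) \<longlongrightarrow> max 0 e) (at_right 0)"
      by (intro tendsto_intros q)
    moreover have "eventually (\<lambda>t. max 0 ((u t - u 0) / t) = (max 0 (u t) - max 0 (u 0)) / t)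
        (at_right 0)"
      unfolding eventually_at_right_field using 3
      by (intro exI[of _ 1]) (auto simp: max_def divide_simps)
    ultimately show ?thesis by (blast intro: Lim_transform_eventually)
  qed
qed

lemma directional_derivative_real:
  fixes f :: "'a::real_normed_vector \<Rightarrow> real"
  assumes "(f has_derivative D) (at x)"
  shows "((\<lambda>t. f (x + t *\<^sub>R d)) has_real_derivative D d) (at 0)"
proof -
  have "((\<lambda>t::real. x + t *\<^sub>R d) has_derivative (\<lambda>t. t *\<^sub>R d)) (at 0)"
    by (auto intro!: derivative_eq_intros)
  moreover have "(f has_derivative D) (at (x + 0 *\<^sub>R d))" using assms by simp
  ultimately have "((\<lambda>t. f (x + t *\<^sub>R d)) has_derivative (\<lambda>t. D (t *\<^sub>R d))) (at 0)"
    by (rule has_derivative_compose)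
  moreover have "(\<lambda>t. D (t *\<^sub>R d)) = (*) (D d)"
    using linear_scale[OF has_derivative_linear[OF assms]] by (auto simp: fun_eq_iff)
  ultimately show ?thesis by (simp add: has_field_derivative_def)
qed

lemma l1_violation_directional_derivative:
  fixes c :: "'a::real_normed_vector \<Rightarrow> real^'q"
  assumes c: "(c has_derivative C) (at x)"
  shows "\<exists>l. ((\<lambda>t. (l1_violation (c (x + t *\<^sub>R d)) - l1_violation (c x)) / t) \<longlongrightarrow> l) (at_right 0)"
proof -
  have "\<exists>l. ((\<lambda>t. (max 0 (c (x + t *\<^sub>R d) $ j) - max 0 (c x $ j)) / t) \<longlongrightarrow> l) (at_right 0)" for j
  proof -
    have "((\<lambda>z. c z $ j) has_derivative (\<lambda>d. C d $ j)) (at x)"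
      by (rule bounded_linear.has_derivative[OF bounded_linear_vec_nth c])
    from max_zero_one_sided_derivative[OF directional_derivative_real[OF this, of d]]
    show ?thesis by simp
  qed
  then have "\<forall>j. \<exists>l. ((\<lambda>t. (max 0 (c (x + t *\<^sub>R d) $ j) - max 0 (c x $ j)) / t) \<longlongrightarrow> l) (at_right 0)"
    by blast
  from choice[OF this] obtain l
    where l: "\<And>j. ((\<lambda>t. (max 0 (c (x + t *\<^sub>R d) $ j) - max 0 (c x $ j)) / t) \<longlongrightarrow> l j) (at_right 0)"
    by blast
  have "((\<lambda>t. \<Sum>j\<in>UNIV. (max 0 (c (x + t *\<^sub>R d) $ j) - max 0 (c x $ j)) / t) \<longlongrightarrow> (\<Sum>j\<in>UNIV. l j))
      (at_right 0)" by (intro tendsto_intros l)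
  then show ?thesis
    unfolding l1_violation_eq sum_subtractf[symmetric] sum_divide_distrib by blast
qed

text \<open>Since the one-sided derivatives of the merit function exist, stationarity can only fail through a
  negative one.  The penalty being Lipschitz, replacing the constraints by their linearization
  changes the difference quotients by \<open>o(1)\<close>, so the model decreases along the same direction.\<close>

lemma nonstationary_linear_model_decrease:
  fixes \<psi> :: "'a::real_inner \<Rightarrow> real" and c :: "'a \<Rightarrow> real^'q"
  assumes \<psi>: "GDERIV \<psi> x :> g" and c: "(c has_derivative C) (at x)" and "0 < \<pi>"
    and ns: "\<not> stationary_point (\<lambda>x. \<psi> x + \<pi> * l1_violation (c x)) x"
  shows "\<exists>q. g \<bullet> q + \<pi> * l1_violation (c x + C q) < \<pi> * l1_violation (c x)"
proof -
  let ?\<phi> = "\<lambda>x. \<psi> x + \<pi> * l1_violation (c x)"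
  have \<psi>d: "((\<lambda>t. (\<psi> (x + t *\<^sub>R d) - \<psi> x) / t) \<longlongrightarrow> g \<bullet> d) (at_right 0)" for d
  proof -
    have "(\<psi> has_derivative (\<lambda>h. h \<bullet> g)) (at x)" using \<psi> by (simp add: gderiv_def)
    from directional_derivative_real[OF this, of d] show ?thesis
      unfolding has_field_derivative_iff by (simp add: filterlim_at_split inner_commute)
  qed
  have ex: "\<exists>l. ((\<lambda>t. (?\<phi> (x + t *\<^sub>R d) - ?\<phi> x) / t) \<longlongrightarrow> l) (at_right 0)" for d
  proof -
    obtain l where l: "((\<lambda>t. (l1_violation (c (x + t *\<^sub>R d)) - l1_violation (c x)) / t) \<longlongrightarrow> l) (at_right 0)"
      using l1_violation_directional_derivative[OF c] by blast
    have "((\<lambda>t. (\<psi> (x + t *\<^sub>R d) - \<psi> x) / t + \<pi> * ((l1_violation (c (x + t *\<^sub>R d)) - l1_violation (c x)) / t))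
        \<longlongrightarrow> g \<bullet> d + \<pi> * l) (at_right 0)"
      by (intro tendsto_intros l \<psi>d)
    moreover have "(\<lambda>t. (\<psi> (x + t *\<^sub>R d) - \<psi> x) / t + \<pi> * ((l1_violation (c (x + t *\<^sub>R d)) - l1_violation (c x)) / t))
       = (\<lambda>t. (?\<phi> (x + t *\<^sub>R d) - ?\<phi> x) / t)"
      by (auto simp: fun_eq_iff divide_simps algebra_simps)
    ultimately show ?thesis by auto
  qed
  obtain d l where l: "((\<lambda>t. (?\<phi> (x + t *\<^sub>R d) - ?\<phi> x) / t) \<longlongrightarrow> l) (at_right 0)" "l < 0"
  proof -
    from ns obtain d where d: "\<And>l. ((\<lambda>t. (?\<phi> (x + t *\<^sub>R d) - ?\<phi> x) / t) \<longlongrightarrow> l) (at_right 0) \<Longrightarrow> \<not> 0 \<le> l"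
      unfolding stationary_point_def subdifferential_def by auto
    with ex[of d] show ?thesis using that by (meson not_le)
  qed
  have C0: "((\<lambda>t. norm (c (x + t *\<^sub>R d) - c x - C (t *\<^sub>R d)) / t) \<longlongrightarrow> 0) (at_right 0)"
  proof -
    have 1: "((\<lambda>t::real. x + t *\<^sub>R d) has_derivative (\<lambda>t. t *\<^sub>R d)) (at 0)"
      by (auto intro!: derivative_eq_intros)
    have "(c has_derivative C) (at (x + 0 *\<^sub>R d))" using c by simp
    from has_derivative_compose[OF 1 this]
    have "((\<lambda>t. c (x + t *\<^sub>R d)) has_derivative (\<lambda>t. C (t *\<^sub>R d))) (at 0)" .
    then have "((\<lambda>t. norm (c (x + t *\<^sub>R d) - c x - C (t *\<^sub>R d)) / \<bar>t\<bar>) \<longlongrightarrow> 0) (at 0)"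
      by (simp add: has_derivative_at)
    then have "((\<lambda>t. norm (c (x + t *\<^sub>R d) - c x - C (t *\<^sub>R d)) / \<bar>t\<bar>) \<longlongrightarrow> 0) (at_right 0)"
      by (simp add: filterlim_at_split)
    then show ?thesis
      by (rule Lim_transform_eventually) (auto simp: eventually_at_right_field intro!: exI[of _ 1])
  qed
  let ?K = "\<pi> * real CARD('q)"
  \<comment> \<open>an upper bound for the difference quotient of the model: that of the merit function with the
    one for \<open>\<psi>\<close> replaced by its limit, plus the linearization error of the penalty\<close>
  define Q where "Q t = (?\<phi> (x + t *\<^sub>R d) - ?\<phi> x) / t - (\<psi> (x + t *\<^sub>R d) - \<psi> x) / t + g \<bullet> d
      + ?K * (norm (c (x + t *\<^sub>R d) - c x - C (t *\<^sub>R d)) / t)" for t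
  have "(Q \<longlongrightarrow> l - g \<bullet> d + g \<bullet> d + ?K * 0) (at_right 0)"
    unfolding Q_def by (intro tendsto_add tendsto_diff tendsto_mult tendsto_const l(1) \<psi>d C0)
  then have "eventually (\<lambda>t. Q t < 0) (at_right 0)"
    by (rule order_tendstoD) (use l in simp)
  then have "eventually (\<lambda>t. 0 < t \<and> Q t < 0) (at_right 0)"
    using eventually_at_right_less[of "0::real"] by (rule eventually_conj[rotated])
  then have "\<exists>t. 0 < t \<and> Q t < 0"
    by (rule eventually_happens'[rotated]) (rule trivial_limit_at_right_real)
  then obtain t where t: "0 < t" and neg: "Q t < 0" by blast
  define n where "n = norm (c (x + t *\<^sub>R d) - c x - C (t *\<^sub>R d))"
  have "Q t = (\<pi> * l1_violation (c (x + t *\<^sub>R d)) - \<pi> * l1_violation (c x) + g \<bullet> (t *\<^sub>R d)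
      + ?K * n) / t"
    using t unfolding Q_def n_def[symmetric]
    by (simp add: divide_inverse algebra_simps)
  with neg t have 1: "\<pi> * l1_violation (c (x + t *\<^sub>R d)) - \<pi> * l1_violation (c x) + g \<bullet> (t *\<^sub>R d)
      + ?K * n < 0"
    by (simp add: divide_less_0_iff)
  have "l1_violation (c x + C (t *\<^sub>R d)) - l1_violation (c (x + t *\<^sub>R d))
      \<le> real CARD('q) * n"
    using l1_violation_lipschitz[of "c x + C (t *\<^sub>R d)" "c (x + t *\<^sub>R d)"]
    by (simp add: n_def norm_minus_commute algebra_simps)
  from mult_left_mono[OF this, of \<pi>] \<open>0 < \<pi>\<close> 1
  have "g \<bullet> (t *\<^sub>R d) + \<pi> * l1_violation (c x + C (t *\<^sub>R d)) < \<pi> * l1_violation (c x)"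
    by (simp add: algebra_simps)
  then show ?thesis by blast
qed


section \<open>The piecewise smooth model near a nonstationary point\<close>

text \<open>Convexity turns the decrease of the first-order model at one fixed step into a decrease
  proportional to the length of any shorter step in the same direction; the quadratic term is
  negligible against it.\<close>

lemma model_decrease_along_ray:
  fixes c :: "real^'q" and q g :: "'a::real_inner"
  assumes \<beta>: "0 < \<beta>" and \<pi>: "0 < \<pi>" and C: "linear C"
    and dec: "g \<bullet> q + \<pi> * l1_violation (c + C q) \<le> \<pi> * l1_violation c - \<beta>"
    and H: "\<And>p. \<bar>h p\<bar> \<le> Q * (norm p)\<^sup>2"
    and t: "0 \<le> t" "t \<le> 1" "t * (Q * (norm q)\<^sup>2) \<le> \<beta>"
  shows "g \<bullet> (t *\<^sub>R q) + 1/2 * h (t *\<^sub>R q) + \<pi> * l1_violation (c + C (t *\<^sub>R q))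
     \<le> \<pi> * l1_violation c - t * \<beta> / 2"
proof -
  have "l1_violation (c + C (t *\<^sub>R q)) \<le> (1 - t) * l1_violation c + t * l1_violation (c + C q)"
    using l1_violation_convex[OF t(1,2), of c "C q"] by (simp add: linear_scale[OF C])
  from mult_left_mono[OF this, of \<pi>] \<pi>
  have "\<pi> * l1_violation (c + C (t *\<^sub>R q)) \<le> \<pi> * ((1 - t) * l1_violation c + t * l1_violation (c + C q))" by simp
  also have "\<dots> = \<pi> * l1_violation c + t * (\<pi> * l1_violation (c + C q) - \<pi> * l1_violation c)"
    by (simp add: algebra_simps)
  also have "\<dots> \<le> \<pi> * l1_violation c + t * (- g \<bullet> q - \<beta>)"
    using dec t(1) by (intro add_left_mono mult_left_mono) auto
  finally have 1: "g \<bullet> (t *\<^sub>R q) + \<pi> * l1_violation (c + C (t *\<^sub>R q)) \<le> \<pi> * l1_violation c - t * \<beta>"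
    by (simp add: algebra_simps)
  have "h (t *\<^sub>R q) \<le> Q * (norm (t *\<^sub>R q))\<^sup>2" using H[of "t *\<^sub>R q"] by simp
  also have "\<dots> = t * (t * (Q * (norm q)\<^sup>2))" using t(1) by (simp add: power2_eq_square)
  also have "\<dots> \<le> t * \<beta>" using t by (intro mult_left_mono) auto
  finally show ?thesis using 1 by simp
qed

text \<open>The decrease of the first-order model achieved by one fixed step \<open>q\<close> depends continuously on the
  base point, so half of it remains available near \<open>a\<close>; shortening \<open>q\<close> to the trust region retains a
  proportional part.  The model error is bounded by the uniform first-order expansions of \<open>\<psi>\<close> and
  \<open>c\<close> and by the quadratic term.  The function \<open>h\<close> stands for the quadratic form of an arbitrary
  Hessian from a bounded family, which is why it is quantified after the constants.\<close>

lemma nonstationary_model_estimates: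
  fixes \<psi> :: "'a::euclidean_space \<Rightarrow> real" and c :: "'a \<Rightarrow> real^'q"
  assumes r: "0 < r" and \<psi>C: "C1_on (ball a r) \<psi>" and cC: "C1_on (ball a r) c"
    and g: "\<And>x. x \<in> ball a r \<Longrightarrow> GDERIV \<psi> x :> g x"
    and C: "\<And>x. x \<in> ball a r \<Longrightarrow> (c has_derivative C x) (at x)"
    and \<pi>: "0 < \<pi>" and \<epsilon>: "0 < \<epsilon>" and Q0: "0 \<le> Q"
    and ns: "\<not> stationary_point (\<lambda>x. \<psi> x + \<pi> * l1_violation (c x)) a"
  obtains s \<delta> \<kappa> where "0 < s" "s \<le> r" "0 < \<delta>" "0 < \<kappa>"
    "\<And>x h D. x \<in> ball a s \<Longrightarrow> (\<And>p. \<bar>h p\<bar> \<le> Q * (norm p)\<^sup>2) \<Longrightarrow> 0 < D \<Longrightarrow>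
       \<exists>q. norm q \<le> D \<and> g x \<bullet> q + 1/2 * h q + \<pi> * l1_violation (c x + C x q)
           \<le> \<pi> * l1_violation (c x) - \<kappa> * min \<delta> D"
    "\<And>x h p. x \<in> ball a s \<Longrightarrow> (\<And>p. \<bar>h p\<bar> \<le> Q * (norm p)\<^sup>2) \<Longrightarrow> norm p \<le> \<delta> \<Longrightarrow>
       \<bar>\<psi> (x + p) + \<pi> * l1_violation (c (x + p))
         - (\<psi> x + g x \<bullet> p + 1/2 * h p + \<pi> * l1_violation (c x + C x p))\<bar> \<le> \<epsilon> * \<kappa> * norm p"
proof -
  have a: "a \<in> ball a r" using r by simp
  obtain q where q: "g a \<bullet> q + \<pi> * l1_violation (c a + C a q) < \<pi> * l1_violation (c a)"
    using nonstationary_linear_model_decrease[OF g[OF a] C[OF a] \<pi> ns] by blast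
  have linC: "linear (C x)" if "x \<in> ball a r" for x using C[OF that] by (rule has_derivative_linear)
  have "q \<noteq> 0" using q linear_0[OF linC[OF a]] by auto
  then have nq: "0 < norm q" by simp
  define G where "G x = \<pi> * l1_violation (c x) - (g x \<bullet> q + \<pi> * l1_violation (c x + C x q))" for x
  define \<beta> where "\<beta> = G a / 2"
  have \<beta>: "0 < \<beta>" using q by (simp add: \<beta>_def G_def)
  have gq: "continuous_on (ball a r) (\<lambda>x. g x \<bullet> q)"
  proof -
    obtain g' where "\<And>x. x \<in> ball a r \<Longrightarrow> GDERIV \<psi> x :> g' x" "continuous_on (ball a r) g'"
      using C1_on_GDERIV[OF \<psi>C] by blast
    then have "continuous_on (ball a r) g" using g
      by (metis (no_types, lifting) continuous_on_cong grad_eq)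
    then show ?thesis by (intro continuous_intros)
  qed
  have Cq: "continuous_on (ball a r) (\<lambda>x. C x q)"
  proof -
    obtain C' where C': "\<And>x. x \<in> ball a r \<Longrightarrow> (c has_derivative C' x) (at x)"
      "\<And>d. continuous_on (ball a r) (\<lambda>x. C' x d)" using C1_onE[OF cC] by blast
    have "C' x q = C x q" if "x \<in> ball a r" for x
      using has_derivative_unique[OF C'(1)[OF that] C[OF that]] by simp
    with C'(2)[of q] show ?thesis by (metis (no_types, lifting) continuous_on_cong)
  qed
  have "continuous_on (ball a r) G"
    unfolding G_def
    by (intro continuous_intros gq Cq C1_on_continuous[OF cC]
        continuous_on_compose2[OF l1_violation_continuous]) auto
  then have "isCont G a" using a by (simp add: continuous_on_eq_continuous_at)
  then obtain s1 where s1: "0 < s1" "\<And>x. dist x a < s1 \<Longrightarrow> dist (G x) (G a) < \<beta>"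
    using \<beta> unfolding continuous_at_eps_delta by blast
  \<comment> \<open>a fraction of \<open>q\<close> so small that the quadratic term consumes at most half of the decrease\<close>
  define t0 where "t0 = min 1 (\<beta> / (Q * (norm q)\<^sup>2 + 1))"
  have Qq: "0 < Q * (norm q)\<^sup>2 + 1" using Q0 by (simp add: add_nonneg_pos)
  have t0: "0 < t0" "t0 \<le> 1" using \<beta> Qq by (auto simp: t0_def)
  have t0Q: "t0 * (Q * (norm q)\<^sup>2) \<le> \<beta>"
  proof -
    have "t0 * (Q * (norm q)\<^sup>2) \<le> (\<beta> / (Q * (norm q)\<^sup>2 + 1)) * (Q * (norm q)\<^sup>2 + 1)"
      using Q0 \<beta> Qq by (intro mult_mono) (auto simp: t0_def)
    also have "\<dots> = \<beta>" using Qq by simp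
    finally show ?thesis .
  qed
  define \<kappa> where "\<kappa> = \<beta> / (2 * norm q)"
  have \<kappa>: "0 < \<kappa>" using \<beta> nq by (simp add: \<kappa>_def)
  \<comment> \<open>chosen so that the expansion errors of \<open>\<psi>\<close> and of the penalty together take half of the
    error budget; the quadratic term takes the other half\<close>
  define e where "e = \<epsilon> * \<kappa> / (2 * (1 + \<pi> * real CARD('q)))"
  have den: "0 < 1 + \<pi> * real CARD('q)" using \<pi> by (simp add: add_pos_nonneg)
  have e: "0 < e" using \<epsilon> \<kappa> den by (simp add: e_def)
  have g': "(\<psi> has_derivative (\<lambda>d. d \<bullet> g x)) (at x)" if "x \<in> ball a r" for x
    using g[OF that] by (simp add: gderiv_def)
  obtain s2 where s2: "0 < s2" "s2 \<le> r"
    "\<And>x y. x \<in> ball a s2 \<Longrightarrow> y \<in> ball a s2 \<Longrightarrow> norm (\<psi> y - \<psi> x - (y - x) \<bullet> g x) \<le> e * norm (y - x)"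
    using C1_on_uniform_expansion[OF \<psi>C r e g'] by blast
  obtain s3 where s3: "0 < s3" "s3 \<le> r"
    "\<And>x y. x \<in> ball a s3 \<Longrightarrow> y \<in> ball a s3 \<Longrightarrow> norm (c y - c x - C x (y - x)) \<le> e * norm (y - x)"
    using C1_on_uniform_expansion[OF cC r e C] by blast
  \<comment> \<open>half of the available radius, so that base point plus step stays inside\<close>
  define s where "s = min s1 (min s2 s3) / 2"
  define \<delta> where "\<delta> = min (t0 * norm q) (min s (\<epsilon> * \<kappa> / (Q + 1)))"
  have s: "0 < s" "s \<le> s1 / 2" "s \<le> s2 / 2" "s \<le> s3 / 2" using s1 s2 s3 by (auto simp: s_def)
  have \<delta>: "0 < \<delta>" using t0 nq s \<epsilon> \<kappa> Q0 by (auto simp: \<delta>_def)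
  show ?thesis
  proof (rule that[OF s(1) _ \<delta> \<kappa>])
    show "s \<le> r" using s s2 by simp
  next
    fix x and D :: real and h :: "'a \<Rightarrow> real"
    assume x: "x \<in> ball a s" and h: "\<And>p. \<bar>h p\<bar> \<le> Q * (norm p)\<^sup>2" and D: "0 < D"
    have xr: "x \<in> ball a r" using x s s2 by auto
    define t where "t = min t0 (D / norm q)"
    have t: "0 \<le> t" "t \<le> t0" "t \<le> D / norm q" using t0 D nq by (auto simp: t_def)
    have "t * (Q * (norm q)\<^sup>2) \<le> t0 * (Q * (norm q)\<^sup>2)" using t Q0 by (intro mult_right_mono) auto
    with t0Q have tQ: "t * (Q * (norm q)\<^sup>2) \<le> \<beta>" by simp
    have "\<beta> < G x" using s1(2)[of x] x s by (simp add: dist_commute dist_real_def \<beta>_def abs_if split: if_splits)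
    then have "g x \<bullet> q + \<pi> * l1_violation (c x + C x q) \<le> \<pi> * l1_violation (c x) - \<beta>"
      by (simp add: G_def)
    from model_decrease_along_ray[where h = h, OF \<beta> \<pi> linC[OF xr] this h t(1) _ tQ] t t0
    have 1: "g x \<bullet> (t *\<^sub>R q) + 1/2 * h (t *\<^sub>R q) + \<pi> * l1_violation (c x + C x (t *\<^sub>R q))
        \<le> \<pi> * l1_violation (c x) - t * \<beta> / 2" by simp
    have "\<kappa> * min \<delta> D \<le> \<kappa> * (t * norm q)"
    proof (rule mult_left_mono)
      have "t * norm q = min (t0 * norm q) D"
        using nq by (simp add: t_def min_mult_distrib_right)
      then show "min \<delta> D \<le> t * norm q" by (simp add: \<delta>_def)
    qed (use \<kappa> in simp)
    also have "\<dots> = t * \<beta> / 2" using nq by (simp add: \<kappa>_def)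
    finally have 2: "\<kappa> * min \<delta> D \<le> t * \<beta> / 2" .
    have "norm (t *\<^sub>R q) \<le> D" using t nq by (simp add: pos_le_divide_eq)
    with 1 2 show "\<exists>q. norm q \<le> D \<and> g x \<bullet> q + 1/2 * h q + \<pi> * l1_violation (c x + C x q)
           \<le> \<pi> * l1_violation (c x) - \<kappa> * min \<delta> D" by (intro exI[of _ "t *\<^sub>R q"]) linarith
  next
    fix x p :: 'a and h :: "'a \<Rightarrow> real"
    assume x: "x \<in> ball a s" and h: "\<And>p. \<bar>h p\<bar> \<le> Q * (norm p)\<^sup>2" and p: "norm p \<le> \<delta>"
    have "dist a (x + p) \<le> dist a x + norm p"
      using dist_triangle[of a "x + p" x] by (simp add: dist_norm)
    also have "\<dots> < s + s" using x p by (simp add: \<delta>_def)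
    finally have y: "x + p \<in> ball a s2" "x + p \<in> ball a s3" using s by auto
    have x': "x \<in> ball a s2" "x \<in> ball a s3" using x s by auto
    have 1: "\<bar>\<psi> (x + p) - \<psi> x - g x \<bullet> p\<bar> \<le> e * norm p"
      using s2(3)[OF x'(1) y(1)] by (simp add: inner_commute)
    have "norm (c (x + p) - (c x + C x p)) \<le> e * norm p"
      using s3(3)[OF x'(2) y(2)] by (simp add: algebra_simps)
    then have "real CARD('q) * norm (c (x + p) - (c x + C x p)) \<le> real CARD('q) * (e * norm p)"
      by (intro mult_left_mono) auto
    with l1_violation_lipschitz[of "c (x + p)" "c x + C x p"]
    have "\<bar>l1_violation (c (x + p)) - l1_violation (c x + C x p)\<bar> \<le> real CARD('q) * (e * norm p)"
      by linarith
    from mult_left_mono[OF this, of \<pi>] \<pi>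
    have 2: "\<bar>\<pi> * l1_violation (c (x + p)) - \<pi> * l1_violation (c x + C x p)\<bar> \<le> \<pi> * real CARD('q) * e * norm p"
      by (simp add: abs_mult mult.assoc flip: right_diff_distrib)
    have "\<bar>h p\<bar> \<le> Q * (norm p)\<^sup>2" by (rule h)
    also have "\<dots> \<le> (Q + 1) * norm p * norm p" using Q0 by (simp add: power2_eq_square algebra_simps)
    also have "\<dots> \<le> (Q + 1) * (\<epsilon> * \<kappa> / (Q + 1)) * norm p"
      using p Q0 by (intro mult_right_mono mult_left_mono) (auto simp: \<delta>_def)
    also have "\<dots> = \<epsilon> * \<kappa> * norm p" using Q0 by simp
    finally have 3: "\<bar>1/2 * h p\<bar> \<le> \<epsilon> * \<kappa> * norm p / 2" by simp
    have 4: "e * norm p + \<pi> * real CARD('q) * e * norm p = \<epsilon> * \<kappa> * norm p / 2"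
    proof -
      have "e * norm p + \<pi> * real CARD('q) * e * norm p = (1 + \<pi> * real CARD('q)) * e * norm p"
        by (simp add: algebra_simps)
      also have "(1 + \<pi> * real CARD('q)) * e = \<epsilon> * \<kappa> / 2"
      proof -
        have "w * (z / (2 * w)) = z / 2" if "0 < w" for w z :: real using that by simp
        from this[OF den] show ?thesis unfolding e_def .
      qed
      finally show ?thesis by simp
    qed
    have "\<bar>\<psi> (x + p) + \<pi> * l1_violation (c (x + p))
         - (\<psi> x + g x \<bullet> p + 1/2 * h p + \<pi> * l1_violation (c x + C x p))\<bar>
       \<le> \<bar>\<psi> (x + p) - \<psi> x - g x \<bullet> p\<bar> + \<bar>\<pi> * l1_violation (c (x + p)) - \<pi> * l1_violation (c x + C x p)\<bar> + \<bar>1/2 * h p\<bar>"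
      by linarith
    also have "\<dots> \<le> \<epsilon> * \<kappa> * norm p" using 1 2 3 4 by linarith
    finally show "\<bar>\<psi> (x + p) + \<pi> * l1_violation (c (x + p))
         - (\<psi> x + g x \<bullet> p + 1/2 * h p + \<pi> * l1_violation (c x + C x p))\<bar> \<le> \<epsilon> * \<kappa> * norm p" .
  qed
qed


section \<open>The convergence argument for the iterates\<close>

lemma geometric_growth_unbounded:
  fixes D :: "nat \<Rightarrow> real"
  assumes "1 < c" "0 < D k" and step: "\<And>n. n \<ge> k \<Longrightarrow> c * D n \<le> D (Suc n)"
    and bd: "\<And>n. n \<ge> k \<Longrightarrow> D n \<le> b"
  shows False
proof -
  have 1: "c ^ n * D k \<le> D (k + n)" for n
  proof (induction n)
    case (Suc n)
    have "c ^ Suc n * D k = c * (c ^ n * D k)" by simp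
    also have "\<dots> \<le> c * D (k + n)" using Suc \<open>1 < c\<close> by (intro mult_left_mono) auto
    also have "\<dots> \<le> D (k + Suc n)" using step[of "k + n"] by simp
    finally show ?case .
  qed simp
  obtain n where "b / D k < c ^ n" using real_arch_pow[OF \<open>1 < c\<close>] by blast
  then have "b < c ^ n * D k" using \<open>0 < D k\<close> by (simp add: pos_divide_less_eq)
  with 1[of n] bd[of "k + n"] show False by simp
qed

text \<open>
  The argument sees only iterates \<open>x\<close>, radii \<open>D\<close>, merit values \<open>M\<close>, the steps \<open>acc\<close> that are accepted,
  and a property \<open>good\<close> of iterations (the second-stage points lie on the local solution branch).
  The estimates \<open>dec\<close> and \<open>small\<close> are available only at good iterations near \<open>xb\<close>, and \<open>xb\<close> is merely a
  limit of a subsequence; so the heart of the matter is that all late iterations are good and near.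
  This follows because an accepted step moves by at most \<open>(M k - M (Suc k)) / a\<close>, and the total
  merit decrease after a late visit is as small as desired.
\<close>

lemma trust_region_sequence_no_uniform_decrease:
  fixes x :: "nat \<Rightarrow> 'a::real_normed_vector" and D M :: "nat \<Rightarrow> real" and acc good :: "nat \<Rightarrow> bool"
  assumes a: "0 < a" and \<sigma>: "0 < \<sigma>" and \<delta>: "0 < \<delta>" "\<delta> \<le> Dmax"
    and c1: "0 < c1" and c2: "0 < c2" "c2 < 1" "c1 \<le> c2" and c3: "1 < c3"
    and D0: "\<And>k. 0 < D k"
    and mono: "decseq M" and lim: "strict_mono (r :: nat \<Rightarrow> nat)" "(\<lambda>n. x (r n)) \<longlonglongrightarrow> xb" "(\<lambda>n. M (r n)) \<longlonglongrightarrow> Mb"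
      "eventually (\<lambda>n. good (r n)) sequentially"
    and dec: "\<And>k. dist (x k) xb < \<sigma> \<Longrightarrow> good k \<Longrightarrow> acc k \<Longrightarrow> a * min \<delta> (D k) \<le> M k - M (Suc k)"
    and small: "\<And>k. dist (x k) xb < \<sigma> \<Longrightarrow> good k \<Longrightarrow> D k \<le> \<delta> \<Longrightarrow>
        acc k \<and> good (Suc k) \<and> dist (x (Suc k)) (x k) \<le> D k \<and> min (c3 * D k) Dmax \<le> D (Suc k)"
    and rej: "\<And>k. \<not> acc k \<Longrightarrow> x (Suc k) = x k \<and> (good k \<longrightarrow> good (Suc k)) \<and> c1 * D k \<le> D (Suc k) \<and> D (Suc k) \<le> c2 * D k"
  shows False
proof -
  have Mb: "Mb \<le> M k" for k
  proof (rule LIMSEQ_le_const2[OF lim(3)])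
    have "M (r n) \<le> M k" if "n \<ge> k" for n
      using decseqD[OF mono, of k "r n"] that seq_suble[OF lim(1), of n] by simp
    then show "\<exists>N. \<forall>n\<ge>N. M (r n) \<le> M k" by blast
  qed
  \<comment> \<open>\<open>K\<close> below is a visit after which the merit decreases by less than \<open>\<theta>\<close>: too little for an accepted
    step of radius at least \<open>c1 * \<delta>\<close>, and too little for leaving the ball of radius \<open>\<sigma>\<close>\<close>
  define \<theta> where "\<theta> = min (a * (c1 * \<delta>)) (a * (\<sigma> / 2))"
  have "0 < \<theta>" using a \<sigma> \<delta> c1 by (simp add: \<theta>_def)
  have "eventually (\<lambda>n. M (r n) < Mb + \<theta>) sequentially"
    using order_tendstoD(2)[OF lim(3), of "Mb + \<theta>"] \<open>0 < \<theta>\<close> by simp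
  moreover have "eventually (\<lambda>n. dist (x (r n)) xb < \<sigma> / 2) sequentially"
    using tendstoD[OF lim(2), of "\<sigma> / 2"] \<sigma> by simp
  ultimately have "eventually (\<lambda>n. M (r n) < Mb + \<theta> \<and> dist (x (r n)) xb < \<sigma> / 2 \<and> good (r n)) sequentially"
    using lim(4) by eventually_elim auto
  then obtain K where K: "M K < Mb + \<theta>" "dist (x K) xb < \<sigma> / 2" "good K"
    unfolding eventually_sequentially by blast
  have M\<theta>: "M k - M l < \<theta>" if "K \<le> k" for k l
    using decseqD[OF mono that] Mb[of l] K(1) by simp
  have acc_small: "D k < c1 * \<delta>" if "K \<le> k" "dist (x k) xb < \<sigma>" "good k" "acc k" for k
  proof -
    have "a * min \<delta> (D k) < a * (c1 * \<delta>)"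
      using dec[OF that(2-4)] M\<theta>[OF that(1), of "Suc k"] by (simp add: \<theta>_def)
    then have "min \<delta> (D k) < c1 * \<delta>" using a by simp
    moreover have "c1 * \<delta> \<le> 1 * \<delta>" using c2 \<delta> by (intro mult_right_mono) auto
    ultimately show ?thesis by linarith
  qed
  have c1\<delta>: "c1 * \<delta> \<le> \<delta>" using c2 \<delta> mult_right_mono[of c1 1 \<delta>] by simp
  have inv: "a * dist (x k) xb \<le> a * dist (x K) xb + (M K - M k) \<and> good k" if "K \<le> k" for k
    using that
  proof (induction k rule: dec_induct)
    case base
    show ?case using K by simp
  next
    case (step k)
    have "a * dist (x k) xb < a * \<sigma>"
    proof -
      have "a * dist (x K) xb < a * (\<sigma> / 2)" using K(2) a by simp
      moreover have "M K - M k < a * (\<sigma> / 2)" using M\<theta>[of K k] by (simp add: \<theta>_def)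
      ultimately show ?thesis using step.IH by (simp add: field_simps)
    qed
    then have near: "dist (x k) xb < \<sigma>" using a by simp
    show ?case
    proof (cases "acc k")
      case False
      then show ?thesis using rej[OF False] step.IH decseqD[OF mono, of k "Suc k"] by auto
    next
      case True
      have Dk: "D k < c1 * \<delta>" using acc_small near True step by simp
      then have Dk\<delta>: "D k \<le> \<delta>" using c1\<delta> by simp
      note s = small[OF near _ Dk\<delta>]
      have "a * dist (x (Suc k)) xb \<le> a * (dist (x (Suc k)) (x k) + dist (x k) xb)"
        using a by (intro mult_left_mono dist_triangle) auto
      also have "\<dots> \<le> a * D k + a * dist (x k) xb"
        using s step.IH a by (simp add: distrib_left)
      also have "a * D k \<le> M k - M (Suc k)"
        using dec[OF near _ True] step.IH Dk\<delta> by (simp add: min_def split: if_splits)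
      finally show ?thesis using step.IH s by auto
    qed
  qed
  have near: "dist (x k) xb < \<sigma>" if "K \<le> k" for k
  proof -
    have "a * dist (x K) xb < a * (\<sigma> / 2)" using K(2) a by simp
    moreover have "M K - M k < a * (\<sigma> / 2)" using M\<theta>[of K k] by (simp add: \<theta>_def)
    ultimately have "a * dist (x k) xb < a * \<sigma>" using inv[OF that] by (simp add: field_simps)
    then show ?thesis using a by simp
  qed
  show False
  proof (cases "\<exists>k\<ge>K. c1 * \<delta> \<le> D k")
    case True
    then obtain k where k: "K \<le> k" "c1 * \<delta> \<le> D k" by blast
    \<comment> \<open>with radii of at least \<open>c1 * \<delta>\<close> steps are rejected, with radii up to \<open>\<delta>\<close> accepted; so the radius exceeds \<open>\<delta>\<close>
      and one reduction by a factor of at least \<open>c1\<close> leaves it at least \<open>c1 * \<delta>\<close>\<close>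
    have low: "c1 * \<delta> \<le> D l \<and> \<not> acc l" if "k \<le> l" for l
      using that
    proof (induction l rule: dec_induct)
      case base
      show ?case using k acc_small[of k] near inv by fastforce
    next
      case (step l)
      have l: "K \<le> l" using k step by simp
      have "\<not> D l \<le> \<delta>" using small[OF near[OF l]] inv[OF l] step.IH by blast
      then have "c1 * \<delta> \<le> c1 * D l" using c1 by simp
      then have "c1 * \<delta> \<le> D (Suc l)" using rej[of l] step.IH by auto
      then show ?case using acc_small[of "Suc l"] near[of "Suc l"] inv[of "Suc l"] l by fastforce
    qed
    \<comment> \<open>decay of the radii, phrased as growth of their inverses\<close>
    have "inverse (D l) * (1 / c2) \<le> inverse (D (Suc l))" if "k \<le> l" for l
    proof -
      have "D (Suc l) \<le> c2 * D l" using rej low that by blast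
      then have "inverse (c2 * D l) \<le> inverse (D (Suc l))"
        using D0[of "Suc l"] by (intro le_imp_inverse_le)
      then show ?thesis by (simp add: inverse_eq_divide mult.commute)
    qed
    moreover have "inverse (D l) \<le> inverse (c1 * \<delta>)" if "k \<le> l" for l
      using low[OF that] c1 \<delta> by (intro le_imp_inverse_le) auto
    ultimately show False
      using c2 D0[of k] by (intro geometric_growth_unbounded[of "1 / c2" "\<lambda>l. inverse (D l)" k "inverse (c1 * \<delta>)"])
        (auto simp: mult.commute)
  next
    case False
    then have lt: "D k < c1 * \<delta>" if "K \<le> k" for k using that by force
    have "c3 * D k \<le> D (Suc k)" if "K \<le> k" for k
    proof -
      have "min (c3 * D k) Dmax \<le> D (Suc k)"
        using small[OF near[OF that]] inv[OF that] lt[OF that] c1\<delta> by auto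
      moreover have "D (Suc k) < Dmax" using lt[of "Suc k"] that c1\<delta> \<delta>(2) by linarith
      ultimately show ?thesis by simp
    qed
    then show False
      using c3 D0[of K] lt by (intro geometric_growth_unbounded[of c3 D K "c1 * \<delta>"]) (auto intro: less_imp_le)
  qed
qed


section \<open>The smoothed KKT system\<close>

lemma subspace_coord_space: "subspace (coord_space J)"
  by (auto simp: subspace_def coord_space_def)

lemma linear_coord_proj: "linear (coord_proj J)"
  by (rule linearI) (auto simp: coord_proj_def vec_eq_iff)

lemma subspace_var_space: "subspace (var_space P i)"
  unfolding var_space_def by (intro subspace_Times subspace_coord_space subspace_UNIV)

lemma grad_of_derivative:
  fixes f :: "'a::euclidean_space \<Rightarrow> real"
  assumes "(f has_derivative D) (at x)"
  shows "grad f x = (\<Sum>b\<in>Basis. D b *\<^sub>R b)"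
proof (rule grad_eq)
  have lin: "linear D" using assms by (rule has_derivative_linear)
  have "D d = d \<bullet> (\<Sum>b\<in>Basis. D b *\<^sub>R b)" for d
  proof -
    have "d \<bullet> (\<Sum>b\<in>Basis. D b *\<^sub>R b) = (\<Sum>b\<in>Basis. (d \<bullet> b) * D b)"
      by (simp add: inner_sum_right mult.commute)
    also have "\<dots> = D (\<Sum>b\<in>Basis. (d \<bullet> b) *\<^sub>R b)"
      by (simp add: linear_sum[OF lin] linear_scale[OF lin])
    finally show ?thesis by (simp add: euclidean_representation)
  qed
  then have "D = (\<lambda>d. d \<bullet> (\<Sum>b\<in>Basis. D b *\<^sub>R b))" by (rule ext)
  from has_derivative_eq_rhs[OF assms this] show "GDERIV f x :> (\<Sum>b\<in>Basis. D b *\<^sub>R b)"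
    unfolding gderiv_def .
qed

text \<open>An injective linear map on a subspace is bounded below there, which survives small perturbations;
  and an injective endomorphism of a finite-dimensional space is bijective.\<close>

lemma nonsingular_on_subspace_open:
  fixes J :: "'a::euclidean_space \<Rightarrow> 'b::euclidean_space \<Rightarrow>\<^sub>L 'b"
  assumes S: "subspace S" and J: "continuous (at a) J"
    and inj: "inj_on (blinfun_apply (J a)) S"
  obtains r where "0 < r"
    "\<And>x. dist x a < r \<Longrightarrow> blinfun_apply (J x) ` S \<subseteq> S \<Longrightarrow> bij_betw (blinfun_apply (J x)) S S"
proof -
  have "\<forall>d\<in>S. J a d = 0 \<longrightarrow> d = 0"
    using inj subspace_0[OF S] by (auto simp: inj_on_def blinfun.zero_right)
  then obtain e where e: "0 < e" "\<And>d. d \<in> S \<Longrightarrow> e * norm d \<le> norm (J a d)"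
    using injective_imp_isometric[OF closed_subspace[OF S] S blinfun.bounded_linear_right] by blast
  obtain r where r: "0 < r" "\<And>x. dist x a < r \<Longrightarrow> dist (J x) (J a) < e"
    using J e(1) unfolding continuous_at_eps_delta by blast
  show ?thesis
  proof (rule that[OF r(1)])
    fix x assume x: "dist x a < r" and inv: "blinfun_apply (J x) ` S \<subseteq> S"
    have lin: "linear (blinfun_apply (J x))" by (simp add: blinfun.bounded_linear_right bounded_linear.linear)
    have "d = 0" if "d \<in> S" "J x d = 0" for d
    proof (rule ccontr)
      assume "d \<noteq> 0"
      have "norm (J a d) = norm ((J x - J a) d)" using that by (simp add: blinfun.diff_left)
      also have "\<dots> \<le> norm (J x - J a) * norm d" by (rule norm_blinfun)
      also have "\<dots> < e * norm d"
        using r(2)[OF x] \<open>d \<noteq> 0\<close> by (simp add: dist_norm)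
      finally show False using e(2)[OF that(1)] by simp
    qed
    then have i: "inj_on (blinfun_apply (J x)) S"
      by (subst linear_injective_on_subspace_0[OF lin S]) auto
    have "dim (blinfun_apply (J x) ` S) = dim S"
      by (rule dim_image_eq[OF lin]) (use i S in \<open>simp only: span_eq_iff[THEN iffD2]\<close>)
    then have "blinfun_apply (J x) ` S = S"
      using subspace_dim_equal[OF linear_subspace_image[OF lin S] S inv] by simp
    with i show "bij_betw (blinfun_apply (J x)) S S" by (simp add: bij_betw_def)
  qed
qed

text \<open>Difference quotients stay in the subspace, which is closed.\<close>

lemma derivative_preserves_subspace:
  fixes f :: "'a::euclidean_space \<Rightarrow> 'a"
  assumes f: "(f has_derivative D) (at x)" and S: "subspace S"
    and inv: "\<And>y. y \<in> S \<Longrightarrow> f y \<in> S" and "x \<in> S" "d \<in> S"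
  shows "D d \<in> S"
proof -
  have lin: "linear D" using f by (rule has_derivative_linear)
  have 1: "((\<lambda>t::real. x + t *\<^sub>R d) has_derivative (\<lambda>t. t *\<^sub>R d)) (at 0)"
    by (auto intro!: derivative_eq_intros)
  have "(f has_derivative D) (at (x + 0 *\<^sub>R d))" using f by simp
  from has_derivative_compose[OF 1 this]
  have "((\<lambda>t. norm (f (x + t *\<^sub>R d) - f x - D (t *\<^sub>R d)) / \<bar>t\<bar>) \<longlongrightarrow> 0) (at 0)"
    by (simp add: has_derivative_at)
  then have "((\<lambda>t. norm ((f (x + t *\<^sub>R d) - f x) /\<^sub>R t - D d)) \<longlongrightarrow> 0) (at 0)"
  proof (rule Lim_transform_eventually)
    show "\<forall>\<^sub>F t in at 0. norm (f (x + t *\<^sub>R d) - f x - D (t *\<^sub>R d)) / \<bar>t\<bar>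
        = norm ((f (x + t *\<^sub>R d) - f x) /\<^sub>R t - D d)"
      unfolding eventually_at_filter
    proof (intro always_eventually allI impI)
      fix t :: real assume "t \<noteq> 0"
      then have "(f (x + t *\<^sub>R d) - f x) /\<^sub>R t - D d = (f (x + t *\<^sub>R d) - f x - D (t *\<^sub>R d)) /\<^sub>R t"
        by (simp add: linear_scale[OF lin] scaleR_diff_right)
      then show "norm (f (x + t *\<^sub>R d) - f x - D (t *\<^sub>R d)) / \<bar>t\<bar>
        = norm ((f (x + t *\<^sub>R d) - f x) /\<^sub>R t - D d)" by (simp add: divide_inverse mult.commute)
    qed
  qed
  then have "((\<lambda>t. (f (x + t *\<^sub>R d) - f x) /\<^sub>R t) \<longlongrightarrow> D d) (at 0)"
    by (rule LIM_zero_cancel[OF tendsto_norm_zero_cancel])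
  then show ?thesis
  proof (rule Lim_in_closed_set[OF closed_subspace[OF S], rotated 2])
    show "\<forall>\<^sub>F t in at 0. (f (x + t *\<^sub>R d) - f x) /\<^sub>R t \<in> S"
      using \<open>x \<in> S\<close> \<open>d \<in> S\<close>
      by (intro always_eventually allI subspace_scale[OF S] subspace_diff[OF S] inv subspace_add[OF S])
  qed simp
qed


lemma locally_lipschitz_continuous: "locally_lipschitz f \<Longrightarrow> continuous_on UNIV f"
proof (rule continuous_at_imp_continuous_on, rule ballI)
  fix x assume "locally_lipschitz f"
  then obtain u L where "0 < u" "L-lipschitz_on (ball x u) f" unfolding locally_lipschitz_def by blast
  then show "isCont f x"
    using lipschitz_on_continuous_on[of L "ball x u" f]
    by (auto simp: continuous_on_eq_continuous_at)
qed

lemma is_derivative_on_continuous: "is_derivative_on UNIV f f' \<Longrightarrow> continuous_on UNIV f"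
proof (rule continuous_at_imp_continuous_on, rule ballI)
  fix x assume "is_derivative_on UNIV f f'"
  then have "(f has_derivative blinfun_apply (f' x)) (at x)" unfolding is_derivative_on_def by blast
  then show "isCont f x" by (rule has_derivative_continuous)
qed

lemma C2_lip_derivative_C1:
  assumes "C2_lip f"
  obtains f' where "is_derivative_on UNIV f f'" "C1_on UNIV f'"
proof -
  obtain f' f'' where "is_derivative_on UNIV f f'" "is_derivative_on UNIV f' f''" "locally_lipschitz f''"
    using assms unfolding C2_lip_def by blast
  moreover from this have "C1_on UNIV f'"
    unfolding C1_on_def by (intro exI[of _ f''] conjI locally_lipschitz_continuous)
  ultimately show ?thesis using that by blast
qed

lemma C3_derivative_C1:
  assumes "C3 f"
  obtains f' where "is_derivative_on UNIV f f'" "C1_on UNIV f'"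
proof -
  obtain f' f'' f''' where "is_derivative_on UNIV f f'" "is_derivative_on UNIV f' f''" "is_derivative_on UNIV f'' f'''"
    using assms unfolding C3_def by blast
  moreover from this have "C1_on UNIV f'"
    unfolding C1_on_def by (intro exI[of _ f''] conjI is_derivative_on_continuous)
  ultimately show ?thesis using that by blast
qed

text \<open>Either regularity variant makes the first derivatives C1, since a locally Lipschitz or
  differentiable second derivative is continuous.\<close>

lemma regularity_derivatives:
  assumes "regularity_assumption sm P" "i \<in> {1..N P}"
  obtains F' C' where "is_derivative_on UNIV (\<lambda>(y, x). fs P i y x) F'" "C1_on UNIV F'"
    "is_derivative_on UNIV (\<lambda>(y, x). cs P i y x) C'" "C1_on UNIV C'"
proof (cases sm)
  case Solution_Smoothing
  then have "C3 (\<lambda>(y, x). fs P i y x)" "C3 (\<lambda>(y, x). cs P i y x)"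
    using assms by (auto simp: regularity_assumption_def)
  then show ?thesis using that by (metis C3_derivative_C1)
next
  case Objective_Smoothing
  then have "C2_lip (\<lambda>(y, x). fs P i y x)" "C2_lip (\<lambda>(y, x). cs P i y x)"
    using assms by (auto simp: regularity_assumption_def)
  then show ?thesis using that by (metis C2_lip_derivative_C1)
qed

text \<open>The function factors through a projection that annihilates the direction in question.\<close>

lemma derivative_vanishes_on_ignored_coordinate:
  fixes f :: "(real^'n) \<times> ('a::real_normed_vector) \<Rightarrow> 'b::real_normed_vector"
  assumes ign: "\<And>y x. f (y, x) = f (coord_proj J y, x)"
    and f': "\<And>z. (f has_derivative f' z) (at z)" and j: "j \<notin> J"
  shows "f' z (axis j 1, 0) = 0"
proof -
  let ?L = "\<lambda>z. (coord_proj J (fst z), snd z) :: (real^'n) \<times> 'a"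
  have "bounded_linear ?L"
    by (intro bounded_linear_Pair bounded_linear_compose[OF linear_conv_bounded_linear[THEN iffD1, OF linear_coord_proj]]
        bounded_linear_fst bounded_linear_snd)
  then have "(?L has_derivative ?L) (at z)" by (rule bounded_linear_imp_has_derivative)
  from has_derivative_compose[OF this f'[of "?L z"]]
  have "((\<lambda>z. f (?L z)) has_derivative (\<lambda>d. f' (?L z) (?L d))) (at z)" .
  moreover have "(\<lambda>z. f (?L z)) = f" using ign by (auto simp: fun_eq_iff)
  ultimately have "(f has_derivative (\<lambda>d. f' (?L z) (?L d))) (at z)" by simp
  then have "f' z = (\<lambda>d. f' (?L z) (?L d))" by (rule has_derivative_unique[OF f'])
  then have "f' z (axis j 1, 0) = f' (?L z) (?L (axis j 1, 0))" by (rule fun_cong)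
  also have "?L (axis j 1, 0) = 0"
    using j by (auto simp: coord_proj_def axis_def vec_eq_iff zero_prod_def)
  also have "f' (?L z) 0 = 0" using linear_0[OF has_derivative_linear[OF f']] .
  finally show ?thesis .
qed

text \<open>Apart from the shift by the parameter, the KKT map is built from the problem functions and their
  first derivatives by linear and bilinear operations.  The subspace of admissible variables is preserved because the gradients have no components in
  ignored coordinates.\<close>

lemma KKT_map_shift_of_C1:
  fixes P :: "('p::finite,'q::finite,'n::finite,'m::finite) two_stage"
  assumes wf: "well_formed P" and reg: "regularity_assumption sm P" and i: "i \<in> {1..N P}"
  obtains G J where "\<And>x v. KKT_map P i x v = G v - (0, 0, 0, 0, x)"
    "\<And>v. (G has_derivative blinfun_apply (J v)) (at v)" "continuous_on UNIV J"
    "\<And>v. v \<in> var_space P i \<Longrightarrow> G v \<in> var_space P i"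
proof -
  obtain F' C' where F': "is_derivative_on UNIV (\<lambda>(y, x). fs P i y x) F'" "C1_on UNIV F'"
    and C': "is_derivative_on UNIV (\<lambda>(y, x). cs P i y x) C'" "C1_on UNIV C'"
    using regularity_derivatives[OF reg i] by blast
  have dF: "((\<lambda>(y, x). fs P i y x) has_derivative blinfun_apply (F' z)) (at z)" for z
    using F'(1) unfolding is_derivative_on_def by blast
  have dC: "((\<lambda>(y, x). cs P i y x) has_derivative blinfun_apply (C' z)) (at z)" for z
    using C'(1) unfolding is_derivative_on_def by blast
  define pr where "pr v = (fst v, fst (snd v))" for v :: "('p,'n,'m) sub_vars"
  define la where "la v = fst (snd (snd (snd v)))" for v :: "('p,'n,'m) sub_vars"
  define sl where "sl v = fst (snd (snd v))" for v :: "('p,'n,'m) sub_vars"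
  define et where "et v = snd (snd (snd (snd v)))" for v :: "('p,'n,'m) sub_vars"
  note pdefs = pr_def la_def sl_def et_def
  define gy :: "('p,'n,'m) sub_vars \<Rightarrow> real^'n" where
    "gy v = (\<Sum>b\<in>Basis. (blinfun_apply (F' (pr v)) (b, 0) + blinfun_apply (C' (pr v)) (b, 0) \<bullet> la v) *\<^sub>R b)" for v
  define gx :: "('p,'n,'m) sub_vars \<Rightarrow> real^'p" where
    "gx v = (\<Sum>b\<in>Basis. (blinfun_apply (F' (pr v)) (0, b) + blinfun_apply (C' (pr v)) (0, b) \<bullet> la v + b \<bullet> et v) *\<^sub>R b)" for v
  define co :: "('p,'n,'m) sub_vars \<Rightarrow> real^'m" where
    "co v = (\<Sum>j\<in>cidx P i. (sl v $ j * la v $ j - mu P) *\<^sub>R axis j 1)" for v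
  define ce :: "('p,'n,'m) sub_vars \<Rightarrow> real^'m" where
    "ce v = cs P i (fst v) (fst (snd v)) + sl v" for v
  define G :: "('p,'n,'m) sub_vars \<Rightarrow> ('p,'n,'m) sub_vars" where "G v = (gy v, gx v, co v, ce v, fst (snd v))" for v
  have KG: "KKT_map P i x v = G v - (0, 0, 0, 0, x)" for x v
  proof -
    obtain y xt s lam eta where v: "v = (y, xt, s, lam, eta)" by (rule prod_cases5)
    have "((\<lambda>y'. (y', xt)) has_derivative (\<lambda>d. (d, 0))) (at y)"
      by (auto intro!: derivative_eq_intros)
    note 1 = has_derivative_compose[OF this dF[of "(y, xt)"]]
      has_derivative_compose[OF this dC[of "(y, xt)"]]
    have "((\<lambda>y'. lagrangian P i x (y', xt, s, lam, eta)) has_derivative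
        (\<lambda>d. blinfun_apply (F' (y, xt)) (d, 0) + blinfun_apply (C' (y, xt)) (d, 0) \<bullet> lam)) (at y)"
      unfolding lagrangian_def prod.case
      by (rule has_derivative_eq_rhs,
          (rule has_derivative_add has_derivative_inner_left has_derivative_const 1[unfolded prod.case])+)
         simp
    from grad_of_derivative[OF this]
    have gy: "grad (\<lambda>y'. lagrangian P i x (y', xt, s, lam, eta)) y = gy v" by (simp add: gy_def pdefs v)
    have "((\<lambda>x'. (y, x')) has_derivative (\<lambda>d. (0, d))) (at xt)"
      by (auto intro!: derivative_eq_intros)
    note 2 = has_derivative_compose[OF this dF[of "(y, xt)"]]
      has_derivative_compose[OF this dC[of "(y, xt)"]]
    have "((\<lambda>xt'. lagrangian P i x (y, xt', s, lam, eta)) has_derivative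
        (\<lambda>d. blinfun_apply (F' (y, xt)) (0, d) + blinfun_apply (C' (y, xt)) (0, d) \<bullet> lam + d \<bullet> eta)) (at xt)"
      unfolding lagrangian_def prod.case
      by (rule has_derivative_eq_rhs,
          (rule has_derivative_add has_derivative_diff has_derivative_inner_left has_derivative_const
             has_derivative_ident 2[unfolded prod.case])+)
         simp
    from grad_of_derivative[OF this]
    have gx: "grad (\<lambda>xt'. lagrangian P i x (y, xt', s, lam, eta)) xt = gx v" by (simp add: gx_def pdefs v)
    have co: "(\<chi> j. if j \<in> cidx P i then s $ j * lam $ j - mu P else 0) = co v"
      by (auto simp: co_def pdefs v vec_eq_iff axis_def if_distrib[of "\<lambda>x. _ * x"] sum.If_cases
          if_distrib[of "(*) _"] cong: if_cong)
    show ?thesis by (simp add: KKT_map_def G_def v ce_def pdefs gy[unfolded v] gx[unfolded v] co[unfolded v])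
  qed
  note bl = bounded_linear_fst_comp bounded_linear_snd_comp bounded_linear_ident bounded_linear_Pair
  have pr: "C1_on UNIV pr" and la: "C1_on UNIV la" and sl: "C1_on UNIV sl" and et: "C1_on UNIV et"
    unfolding pr_def la_def sl_def et_def by (intro C1_on_bounded_linear bl)+
  have F'pr: "C1_on UNIV (\<lambda>v. F' (pr v))" and C'pr: "C1_on UNIV (\<lambda>v. C' (pr v))"
    by (auto intro!: C1_on_compose[OF pr F'(2)] C1_on_compose[OF pr C'(2)])
  have app: "C1_on UNIV (\<lambda>v. blinfun_apply (F' (pr v)) d)" "C1_on UNIV (\<lambda>v. blinfun_apply (C' (pr v)) d)" for d
    by (intro C1_on_bilinear[OF bounded_bilinear_blinfun_apply] F'pr C'pr C1_on_const)+
  note intro = C1_on_sum C1_on_add C1_on_diff C1_on_bilinear[OF bounded_bilinear_scaleR]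
      C1_on_bilinear[OF bounded_bilinear_inner] C1_on_bilinear[OF bounded_bilinear_mult] app la sl et C1_on_const
  have gy: "C1_on UNIV gy"
    unfolding gy_def[abs_def] by (intro intro)
  have gx: "C1_on UNIV gx"
    unfolding gx_def[abs_def] by (intro intro)
  have co: "C1_on UNIV co"
    unfolding co_def[abs_def] by (intro intro C1_on_linear_compose[OF bounded_linear_vec_nth])
  have "C1_on UNIV (\<lambda>(y, x). cs P i y x)"
    using C'(1) C1_on_continuous[OF C'(2)] unfolding C1_on_def by blast
  from C1_on_compose[OF pr this]
  have ce: "C1_on UNIV ce"
    unfolding ce_def[abs_def] by (intro C1_on_add sl) (simp add: pr_def)
  have "C1_on UNIV G"
    unfolding G_def[abs_def] by (intro C1_on_Pair gy gx co ce C1_on_bounded_linear bl)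
  then obtain J where J: "is_derivative_on UNIV G J" "continuous_on UNIV J" unfolding C1_on_def by blast
  have inv: "G v \<in> var_space P i" if v: "v \<in> var_space P i" for v
  proof -
    obtain y xt s lam eta where v': "v = (y, xt, s, lam, eta)" by (rule prod_cases5)
    have ign: "fs P i y x = fs P i (coord_proj (yidx P i) y) x" "cs P i y x = cs P i (coord_proj (yidx P i) y) x" for y x
      using wf i unfolding well_formed_def by blast+
    have "gy v \<in> coord_space (yidx P i)"
      unfolding coord_space_def
    proof (intro CollectI allI impI)
      fix j assume j: "j \<notin> yidx P i"
      have "F' (y, xt) (axis j 1, 0) = 0"
        by (rule derivative_vanishes_on_ignored_coordinate[where f = "\<lambda>(y, x). fs P i y x", OF _ dF j])
           (unfold prod.case, rule ign)
      moreover have "C' (y, xt) (axis j 1, 0) = 0"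
        by (rule derivative_vanishes_on_ignored_coordinate[where f = "\<lambda>(y, x). cs P i y x", OF _ dC j])
           (unfold prod.case, rule ign)
      ultimately show "gy v $ j = 0"
        unfolding cart_eq_inner_axis[of "gy v"]
        by (simp add: gy_def pdefs v' inner_sum_left_Basis axis_in_Basis_iff)
    qed
    moreover have "co v \<in> coord_space (cidx P i)"
      by (auto simp: co_def pdefs v' coord_space_def axis_def intro!: sum.neutral)
    moreover have "ce v \<in> coord_space (cidx P i)"
    proof -
      have "cs P i y xt \<in> coord_space (cidx P i)" using wf i unfolding well_formed_def by blast
      then show ?thesis using v by (simp add: ce_def pdefs v' var_space_def subspace_add[OF subspace_coord_space])
    qed
    ultimately show ?thesis by (simp add: G_def var_space_def)
  qed
  show ?thesis
  proof (rule that[of G J])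
    show "KKT_map P i x v = G v - (0, 0, 0, 0, x)" for x v by (rule KG)
    show "(G has_derivative blinfun_apply (J v)) (at v)" for v
      using J(1) unfolding is_derivative_on_def by blast
    show "G v \<in> var_space P i" if "v \<in> var_space P i" for v using that by (rule inv)
  qed (rule J(2))
qed

text \<open>The strict inequalities survive the limit because the products \<open>s j * lam j\<close> are all equal to the
  positive number \<open>mu\<close>.\<close>

lemma KKT_set_closed_under_limits:
  fixes P :: "('p::finite,'q::finite,'n::finite,'m::finite) two_stage"
    and X :: "nat \<Rightarrow> real^'p" and V :: "nat \<Rightarrow> ('p,'n,'m) sub_vars"
  assumes wf: "well_formed P" and reg: "regularity_assumption sm P" and i: "i \<in> {1..N P}"
    and X: "X \<longlonglongrightarrow> x" and V: "V \<longlonglongrightarrow> v" and XV: "\<And>n. (X n, V n) \<in> KKT_set P i"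
  shows "(x, v) \<in> KKT_set P i"
proof -
  obtain G J where G: "\<And>x v. KKT_map P i x v = G v - (0, 0, 0, 0, x)"
    "\<And>v. (G has_derivative blinfun_apply (J v)) (at v)" and "continuous_on UNIV J"
    "\<And>v. v \<in> var_space P i \<Longrightarrow> G v \<in> var_space P i"
    using KKT_map_shift_of_C1[OF wf reg i] by metis
  have v: "v \<in> var_space P i"
    by (rule Lim_in_closed_set[OF closed_subspace[OF subspace_var_space] _ _ V])
       (use XV in \<open>auto simp: KKT_set_def\<close>)
  have "isCont G v" using has_derivative_continuous[OF G(2)] .
  then have "(\<lambda>n. G (V n) - (0, 0, 0, 0, X n)) \<longlonglongrightarrow> G v - (0, 0, 0, 0, x)"
    by (intro tendsto_intros X isCont_tendsto_compose[OF _ V])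
  moreover have "G (V n) - (0, 0, 0, 0, X n) = 0" for n using XV[of n] by (simp add: KKT_set_def G(1))
  ultimately have z: "KKT_map P i x v = 0"
    unfolding G(1) by (simp add: LIMSEQ_const_iff)
  obtain y xt s lam eta where v': "v = (y, xt, s, lam, eta)" by (rule prod_cases5)
  have pos: "s $ j > 0 \<and> lam $ j > 0" if j: "j \<in> cidx P i" for j
  proof -
    have s: "(\<lambda>n. fst (snd (snd (V n))) $ j) \<longlonglongrightarrow> s $ j"
      using tendsto_vec_nth[OF tendsto_fst[OF tendsto_snd[OF tendsto_snd[OF V]]]] by (simp add: v')
    have l: "(\<lambda>n. fst (snd (snd (snd (V n)))) $ j) \<longlonglongrightarrow> lam $ j"
      using tendsto_vec_nth[OF tendsto_fst[OF tendsto_snd[OF tendsto_snd[OF tendsto_snd[OF V]]]]] by (simp add: v')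
    have "0 < fst (snd (snd (V n))) $ j" "0 < fst (snd (snd (snd (V n)))) $ j" for n
      using XV[of n] j by (auto simp: KKT_set_def split: prod.splits)
    then have "0 \<le> s $ j" "0 \<le> lam $ j"
      by (auto intro!: LIMSEQ_le_const[OF s] LIMSEQ_le_const[OF l] intro: less_imp_le)
    moreover have "s $ j * lam $ j = mu P"
    proof -
      have "(\<chi> j. if j \<in> cidx P i then s $ j * lam $ j - mu P else 0) = 0"
        using z by (simp add: KKT_map_def v' zero_prod_def)
      from arg_cong[OF this, of "\<lambda>z. z $ j"] show ?thesis using j by simp
    qed
    moreover have "0 < mu P" using wf unfolding well_formed_def by blast
    ultimately show ?thesis by (metis less_eq_real_def mult_zero_left mult_zero_right)
  qed
  show ?thesis using v z pos by (simp add: KKT_set_def v')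
qed

text \<open>The derivative of the KKT map is independent of the parameter; hence only the distance of the
  variables matters.\<close>

lemma nondegenerate_open:
  fixes P :: "('p::finite,'q::finite,'n::finite,'m::finite) two_stage"
  assumes wf: "well_formed P" and reg: "regularity_assumption sm P" and i: "i \<in> {1..N P}"
    and nd: "nondegenerate P i x v"
  obtains r where "0 < r"
    "\<And>x' v'. dist v' v < r \<Longrightarrow> (x', v') \<in> KKT_set P i \<Longrightarrow> nondegenerate P i x' v'"
proof -
  obtain G J where G: "\<And>x v. KKT_map P i x v = G v - (0, 0, 0, 0, x)"
    and J: "\<And>v. (G has_derivative blinfun_apply (J v)) (at v)" "continuous_on UNIV J"
    and inv: "\<And>v. v \<in> var_space P i \<Longrightarrow> G v \<in> var_space P i"
    using KKT_map_shift_of_C1[OF wf reg i] by metis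
  have der: "(KKT_map P i x has_derivative blinfun_apply (J v)) (at v)" for x v
  proof -
    have "KKT_map P i x = (\<lambda>v. G v - (0, 0, 0, 0, x))" by (rule ext) (rule G)
    then show ?thesis using has_derivative_diff[OF J(1)[of v] has_derivative_const[of "(0, 0, 0, 0, x)"]] by simp
  qed
  obtain D where D: "(KKT_map P i x has_derivative D) (at v)" "bij_betw D (var_space P i) (var_space P i)"
    using nd unfolding nondegenerate_def KKT_jacobian_nonsingular_def by blast
  have "D = blinfun_apply (J v)" using D(1) der by (rule has_derivative_unique)
  then have inj: "inj_on (blinfun_apply (J v)) (var_space P i)" using D(2) by (simp add: bij_betw_def)
  have "isCont J v" using J(2) continuous_on_eq_continuous_at[OF open_UNIV] by blast
  from nonsingular_on_subspace_open[OF subspace_var_space this inj]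
  obtain r where r: "0 < r" "\<And>v'. dist v' v < r \<Longrightarrow> blinfun_apply (J v') ` var_space P i \<subseteq> var_space P i \<Longrightarrow>
      bij_betw (blinfun_apply (J v')) (var_space P i) (var_space P i)" by blast
  show ?thesis
  proof (rule that[OF r(1)])
    fix x' v' assume 1: "dist v' v < r" and 2: "(x', v') \<in> KKT_set P i"
    have "v' \<in> var_space P i" using 2 by (simp add: KKT_set_def)
    then have "blinfun_apply (J v') ` var_space P i \<subseteq> var_space P i"
      using derivative_preserves_subspace[OF J(1) subspace_var_space inv] by blast
    from r(2)[OF 1 this] der 2 show "nondegenerate P i x' v'"
      unfolding nondegenerate_def KKT_jacobian_nonsingular_def by blast
  qed
qed


section \<open>Local second-stage functions\<close>

lemma local_solution_map_C1:
  assumes "admissible_radii P i xb vb r r2"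
  shows "C1_solution_map_at P i xb vb r (local_solution_map P i xb vb r)"
  using assms unfolding admissible_radii_def local_solution_map_def by (metis someI)

text \<open>The map picked by the choice operator agrees on the ball with the one whose graph is the zero
  level set, by the uniqueness part of the radii's definition.\<close>

lemma local_solution_map_unique:
  assumes adm: "admissible_radii P i xb vb r r2" and KKT: "(x, v) \<in> KKT_set P i" and near: "(x, v) \<in> ball (xb, vb) r2"
  shows "x \<in> ball xb r" "v = local_solution_map P i xb vb r x"
proof -
  obtain w where w: "\<And>w'. C1_solution_map_at P i xb vb r w' \<Longrightarrow> \<forall>x\<in>ball xb r. w' x = w x"
    and lev: "{(x, v). v \<in> var_space P i \<and> KKT_map P i x v = 0} \<inter> ball (xb, vb) r2
            = {(x, v). x \<in> ball xb r \<and> v = w x} \<inter> ball (xb, vb) r2"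
    using adm unfolding admissible_radii_def by blast
  have "(x, v) \<in> {(x, v). v \<in> var_space P i \<and> KKT_map P i x v = 0} \<inter> ball (xb, vb) r2"
    using KKT near by (auto simp: KKT_set_def)
  then have "x \<in> ball xb r" "v = w x" unfolding lev by auto
  with w[OF local_solution_map_C1[OF adm]]
  show "x \<in> ball xb r" "v = local_solution_map P i xb vb r x" by auto
qed

text \<open>The logarithms are smooth here, since the slacks of KKT points are positive.\<close>

lemma local_fhat_C1:
  fixes P :: "('p::finite,'q::finite,'n::finite,'m::finite) two_stage"
  assumes reg: "regularity_assumption sm P" and i: "i \<in> {1..N P}"
    and adm: "admissible_radii P i xb vb (r1 i xb vb) r2"
  shows "C1_on (ball xb (r1 i xb vb)) (local_fhat sm P r1 i xb vb)"
proof -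
  let ?B = "ball xb (r1 i xb vb)"
  define w where "w = local_solution_map P i xb vb (r1 i xb vb)"
  have w: "C1_on ?B w" "\<And>x. x \<in> ?B \<Longrightarrow> (x, w x) \<in> KKT_set P i"
    using local_solution_map_C1[OF adm] unfolding C1_solution_map_at_def solution_map_def w_def by auto
  obtain F' C' where F': "is_derivative_on UNIV (\<lambda>(y, x). fs P i y x) F'" "C1_on UNIV F'"
    and "is_derivative_on UNIV (\<lambda>(y, x). cs P i y x) C'" "C1_on UNIV C'"
    using regularity_derivatives[OF reg i] by metis
  have "C1_on UNIV (\<lambda>(y, x). fs P i y x)"
    using F'(1) C1_on_continuous[OF F'(2)] unfolding C1_on_def by blast
  moreover have "C1_on ?B (\<lambda>x. (fst (w x), x))"
    by (intro C1_on_Pair C1_on_linear_compose[OF bounded_linear_fst w(1)] C1_on_bounded_linear bounded_linear_ident)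
  ultimately have "C1_on ?B (\<lambda>x. case (fst (w x), x) of (y, x) \<Rightarrow> fs P i y x)"
    using C1_on_compose[of ?B "\<lambda>x. (fst (w x), x)" UNIV "\<lambda>(y, x). fs P i y x"] by blast
  then have f: "C1_on ?B (\<lambda>x. fs P i (fst (w x)) x)" by simp
  have ln: "C1_on ?B (\<lambda>x. ln (fst (snd (snd (w x))) $ j))" if j: "j \<in> cidx P i" for j
  proof (rule C1_on_compose[OF _ C1_on_ln])
    show "C1_on ?B (\<lambda>x. fst (snd (snd (w x))) $ j)"
      by (intro C1_on_linear_compose[OF bounded_linear_vec_nth] C1_on_linear_compose[OF bounded_linear_fst]
          C1_on_linear_compose[OF bounded_linear_snd] w(1))
    show "fst (snd (snd (w x))) $ j \<in> {0<..}" if "x \<in> ?B" for x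
      using w(2)[OF that] j by (auto simp: KKT_set_def split: prod.splits)
  qed
  show ?thesis
  proof (cases sm)
    case Solution_Smoothing
    then have "local_fhat sm P r1 i xb vb = (\<lambda>x. fs P i (fst (w x)) x)"
      by (auto simp: local_fhat_def fhat_def w_def fun_eq_iff split: prod.splits)
    with f show ?thesis by simp
  next
    case Objective_Smoothing
    then have "local_fhat sm P r1 i xb vb = (\<lambda>x. fs P i (fst (w x)) x - mu P * (\<Sum>j\<in>cidx P i. ln (fst (snd (snd (w x))) $ j)))"
      by (auto simp: local_fhat_def fhat_def w_def fun_eq_iff split: prod.splits)
    moreover have "C1_on ?B \<dots>"
      by (intro C1_on_diff f C1_on_bilinear[OF bounded_bilinear_mult] C1_on_const C1_on_sum ln)
    ultimately show ?thesis by simp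
  qed
qed

text \<open>The solver differentiates the local function that belongs to its current point; this
  function coincides near that point with the local function of any reference point close by,
  because both graphs are the zero level set of the KKT map.\<close>

lemma gradient_independent_of_reference_point:
  fixes P :: "('p::finite,'q::finite,'n::finite,'m::finite) two_stage"
  assumes adm: "admissible_radii P i xb vb (r1 i xb vb) r2"
    and w: "w = local_solution_map P i xb vb (r1 i xb vb)"
    and near: "(x, w x) \<in> ball (xb, vb) r2"
    and nd: "nondegenerate P i x (w x)" and adm': "admissible_radii P i x (w x) (r1 i x (w x)) r2'"
    and cg: "correct_gradient sm P r1 i x (w x) g"
  shows "GDERIV (local_fhat sm P r1 i xb vb) x :> g"
proof -
  let ?B = "ball x (r1 i x (w x))"
  define u where "u = local_solution_map P i x (w x) (r1 i x (w x))"
  have u: "continuous_on ?B u" "\<And>y. y \<in> ?B \<Longrightarrow> (y, u y) \<in> KKT_set P i" "u x = w x"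
    using local_solution_map_C1[OF adm'] unfolding C1_solution_map_at_def solution_map_def u_def by auto
  have x: "x \<in> ?B" using adm' by (simp add: admissible_radii_def)
  define S where "S = {y \<in> ?B. (y, u y) \<in> ball (xb, vb) r2}"
  have "continuous_on ?B (\<lambda>y. (y, u y))" by (intro continuous_intros u(1))
  then have "open S"
    using continuous_open_preimage[of ?B "\<lambda>y. (y, u y)" "ball (xb, vb) r2"]
    unfolding S_def vimage_def Int_def by simp
  moreover have "x \<in> S" using x near u(3) by (simp add: S_def)
  moreover have "local_fhat sm P r1 i x (w x) y = local_fhat sm P r1 i xb vb y" if "y \<in> S" for y
  proof -
    have "u y = w y"
      using local_solution_map_unique(2)[OF adm u(2)] that unfolding S_def w by blast
    then show ?thesis by (simp add: local_fhat_def u_def w)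
  qed
  moreover have "(local_fhat sm P r1 i x (w x) has_derivative (\<lambda>d. d \<bullet> g)) (at x)"
    using cg nd by (simp add: correct_gradient_def gderiv_def)
  ultimately show ?thesis
    unfolding gderiv_def using has_derivative_transform_within_open by blast
qed

lemma iterates_KKT:
  fixes P :: "('p::finite,'q::finite,'n::finite,'m::finite) two_stage"
  assumes run: "trust_region_run sm P r1 T solver R" and feas: "feasibility_assumption P solver R"
    and i: "i \<in> {1..N P}"
  shows "(itx R k, itv R k i) \<in> KKT_set P i"
proof (induction k)
  case 0
  show ?case using run feas i by (auto simp: trust_region_run_def feasibility_assumption_def)
next
  case (Suc k)
  have "(itx R k + itp R k, trial_v solver R k i) \<in> KKT_set P i"
    using feas i unfolding feasibility_assumption_def by blast
  moreover have "(itx R (Suc k) = itx R k + itp R k \<and> itv R (Suc k) i = trial_v solver R k i) \<or>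
      (itx R (Suc k) = itx R k \<and> itv R (Suc k) i = itv R k i)"
    using run i unfolding trust_region_run_def Let_def by metis
  ultimately show ?case using Suc by auto
qed

text \<open>Consistent output keeps the trial points of short steps in the ball where all KKT points lie on the
  graph of \<open>w\<close>, and nondegeneracy of the iterates near the limit ties the gradients returned by the
  solver to local functions.\<close>

lemma subproblem_data_near_limit:
  fixes P :: "('p::finite,'q::finite,'n::finite,'m::finite) two_stage"
  assumes wf: "well_formed P" and reg: "regularity_assumption sm P" and i: "i \<in> {1..N P}"
    and radii: "\<And>xb vb. nondegenerate P i xb vb \<Longrightarrow> admissible_radii P i xb vb (r1 i xb vb) (r2 i xb vb)"
    and run: "trust_region_run sm P r1 T solver R" and feas: "feasibility_assumption P solver R"
    and cons: "consistent_output_assumption P r2 solver R"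
    and nd: "nondegenerate P i xb vb"
    and X: "(\<lambda>n. itx R (r n)) \<longlonglongrightarrow> xb" and V: "(\<lambda>n. itv R (r n) i) \<longlonglongrightarrow> vb"
    and w: "w = local_solution_map P i xb vb (r1 i xb vb)"
  shows "\<exists>s>0. C1_on (ball xb s) (local_fhat sm P r1 i xb vb)
    \<and> (\<forall>k. itx R k \<in> ball xb s \<longrightarrow> itv R k i = w (itx R k) \<longrightarrow>
         GDERIV (local_fhat sm P r1 i xb vb) (itx R k) :> itg R k i \<and>
         (norm (itp R k) \<le> s \<longrightarrow> trial_v solver R k i = w (itx R k + itp R k)))
    \<and> eventually (\<lambda>n. itv R (r n) i = w (itx R (r n))) sequentially"
proof -
  note adm = radii[OF nd]
  let ?r1 = "r1 i xb vb" and ?r2 = "r2 i xb vb"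
  have r2: "0 < ?r2" "?r2 \<le> ?r1" using adm by (auto simp: admissible_radii_def)
  have wC: "continuous_on (ball xb ?r1) w" "w xb = vb"
    and wK: "\<And>x. x \<in> ball xb ?r1 \<Longrightarrow> (x, w x) \<in> KKT_set P i"
    using local_solution_map_C1[OF adm] unfolding C1_solution_map_at_def solution_map_def w by auto
  obtain r4 where r4: "0 < r4"
    "\<And>x' v'. dist v' vb < r4 \<Longrightarrow> (x', v') \<in> KKT_set P i \<Longrightarrow> nondegenerate P i x' v'"
    using nondegenerate_open[OF wf reg i nd] by metis
  have "\<exists>r3>0. \<forall>k. (itx R k, itv R k i) \<in> KKT_set P i \<inter> ball (xb, vb) r3 \<longrightarrow>
           (\<forall>p. norm p \<le> r3 \<longrightarrow>
              (itx R k + p, solver i (itx R k + p) (itv R k i)) \<in> ball (xb, vb) ?r2)"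
    using cons i nd unfolding consistent_output_assumption_def by blast
  then obtain r3 where r3: "0 < r3"
    "\<And>k p. (itx R k, itv R k i) \<in> KKT_set P i \<Longrightarrow> (itx R k, itv R k i) \<in> ball (xb, vb) r3 \<Longrightarrow> norm p \<le> r3 \<Longrightarrow>
        (itx R k + p, solver i (itx R k + p) (itv R k i)) \<in> ball (xb, vb) ?r2" by blast
  \<comment> \<open>within distance \<open>e\<close> of the reference point, points of the graph are in the uniqueness ball, are
    nondegenerate, and satisfy the premise of consistent output\<close>
  define e where "e = min ?r2 (min r3 r4)"
  have e: "0 < e" using r2 r3 r4 by (simp add: e_def)
  have "isCont (\<lambda>x. (x, w x)) xb"
    using wC(1) r2 by (intro continuous_intros) (simp add: continuous_on_eq_continuous_at)
  then obtain d where d: "0 < d" "\<And>x. dist x xb < d \<Longrightarrow> dist (x, w x) (xb, vb) < e"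
    using e wC(2) unfolding continuous_at_eps_delta by metis
  define s where "s = min d (min r3 ?r1)"
  have s: "0 < s" "s \<le> d" "s \<le> r3" "s \<le> ?r1" using d r3 r2 by (auto simp: s_def)
  have 1: "GDERIV (local_fhat sm P r1 i xb vb) (itx R k) :> itg R k i"
    "norm (itp R k) \<le> s \<Longrightarrow> trial_v solver R k i = w (itx R k + itp R k)"
    if x: "itx R k \<in> ball xb s" and v: "itv R k i = w (itx R k)" for k
  proof -
    have de: "dist (itx R k, w (itx R k)) (xb, vb) < e" using d(2)[of "itx R k"] x s by (simp add: dist_commute)
    have K: "(itx R k, w (itx R k)) \<in> KKT_set P i" using iterates_KKT[OF run feas i, of k] v by simp
    have "dist (w (itx R k)) vb < r4"
      using dist_snd_le[of "(itx R k, w (itx R k))" "(xb, vb)"] de by (simp add: e_def)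
    then have nd': "nondegenerate P i (itx R k) (w (itx R k))" using r4(2) K by blast
    have cg: "correct_gradient sm P r1 i (itx R k) (w (itx R k)) (itg R k i)"
      using run i unfolding trust_region_run_def v[symmetric] by blast
    have in2: "(itx R k, w (itx R k)) \<in> ball (xb, vb) ?r2" using de by (simp add: e_def dist_commute)
    show "GDERIV (local_fhat sm P r1 i xb vb) (itx R k) :> itg R k i"
      by (rule gradient_independent_of_reference_point[where w = w]) (fact adm w in2 nd' radii[OF nd'] cg)+
    assume p: "norm (itp R k) \<le> s"
    have "(itx R k + itp R k, solver i (itx R k + itp R k) (itv R k i)) \<in> ball (xb, vb) ?r2"
      by (rule r3(2)) (use K v de p s in \<open>auto simp: e_def dist_commute\<close>)
    moreover have "(itx R k + itp R k, trial_v solver R k i) \<in> KKT_set P i"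
      using feas i unfolding feasibility_assumption_def by blast
    ultimately show "trial_v solver R k i = w (itx R k + itp R k)"
      using local_solution_map_unique(2)[OF adm] unfolding w trial_v_def by blast
  qed
  have "(\<lambda>n. (itx R (r n), itv R (r n) i)) \<longlonglongrightarrow> (xb, vb)" by (intro tendsto_intros X V)
  then have "eventually (\<lambda>n. dist (itx R (r n), itv R (r n) i) (xb, vb) < ?r2) sequentially"
    by (rule tendstoD[OF _ r2(1)])
  then have 2: "eventually (\<lambda>n. itv R (r n) i = w (itx R (r n))) sequentially"
  proof eventually_elim
    case (elim n)
    then show ?case
      using local_solution_map_unique(2)[OF adm iterates_KKT[OF run feas i]] unfolding w
      by (simp add: dist_commute)
  qed
  have "C1_on (ball xb s) (local_fhat sm P r1 i xb vb)"
    by (rule C1_on_subset[OF local_fhat_C1[where ?r1.0 = r1, OF reg i adm] subset_ball[OF s(4)]])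
  with s(1) 1 2 show ?thesis by blast
qed


section \<open>Stationarity of limit points\<close>

lemma merit_l1: "merit sm P \<pi> x v = f0 P x + (\<Sum>i = 1..N P. fhat sm P i x (v i)) + \<pi> * l1_violation (c0 P x)"
  by (simp add: merit_def l1_violation_def)

text \<open>Used with \<open>u\<close> the values of the local second-stage functions, this identifies the merit values of
  the run with those of the local merit function.\<close>

lemma merit_cong:
  assumes "\<And>i. i \<in> {1..N P} \<Longrightarrow> fhat sm P i x (v i) = u i"
  shows "merit sm P \<pi> x v = f0 P x + (\<Sum>i = 1..N P. u i) + \<pi> * l1_violation (c0 P x)"
  unfolding merit_l1 by (intro arg_cong2[of _ _ _ _ plus] sum.cong refl assms)

lemma run_model_l1:
  "run_model sm P T R k p = f0 P (itx R k) + (\<Sum>i = 1..N P. fhat sm P i (itx R k) (itv R k i))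
     + (grad (f0 P) (itx R k) + (\<Sum>i = 1..N P. itg R k i)) \<bullet> p + 1/2 * (p \<bullet> (itH R k *v p))
     + penalty T * l1_violation (c0 P (itx R k) + jacobian (c0 P) (at (itx R k)) *v p)"
  by (simp add: run_model_def model_def l1_violation_def)

lemma run_model_zero: "run_model sm P T R k 0 = merit sm P (penalty T) (itx R k) (itv R k)"
  by (simp add: run_model_l1 merit_l1)

lemma C1_lip_C1: "C1_lip f \<Longrightarrow> C1_on U f"
  using locally_lipschitz_continuous[of "f'" for f'] unfolding C1_lip_def C1_on_def is_derivative_on_def
  by (meson UNIV_I continuous_on_subset subset_UNIV)

lemma bounded_quadratic_forms:
  fixes H :: "'i \<Rightarrow> real^'p^'p"
  assumes "bounded (range H)"
  obtains Q where "0 \<le> Q" "\<And>k p. \<bar>p \<bullet> (H k *v p)\<bar> \<le> Q * (norm p)\<^sup>2"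
proof -
  obtain B where B: "\<And>k. norm (H k) \<le> B" using assms by (auto simp: bounded_iff)
  let ?Q = "real CARD('p) * real CARD('p) * B"
  have "0 \<le> B" using norm_ge_zero B order_trans by blast
  have "\<bar>p \<bullet> (H k *v p)\<bar> \<le> ?Q * (norm p)\<^sup>2" for k p
  proof -
    have "\<bar>H k $ i $ j\<bar> \<le> B" for i j
    proof -
      have "\<bar>H k $ i $ j\<bar> \<le> norm (H k $ i)" by (rule component_le_norm_cart)
      also have "\<dots> \<le> norm (H k)" by (rule Finite_Cartesian_Product.norm_nth_le)
      finally show ?thesis using B[of k] by simp
    qed
    then have "onorm ((*v) (H k)) \<le> ?Q" by (rule onorm_le_matrix_component)
    then have "onorm ((*v) (H k)) * norm p \<le> ?Q * norm p" by (rule mult_right_mono) simp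
    with onorm[OF matrix_vector_mul_bounded_linear, of "H k" p]
    have "norm (H k *v p) \<le> ?Q * norm p" by linarith
    then have "norm p * norm (H k *v p) \<le> norm p * (?Q * norm p)" by (rule mult_left_mono) simp
    with Cauchy_Schwarz_ineq2[of p "H k *v p"] show ?thesis by (simp add: power2_eq_square algebra_simps)
  qed
  then show ?thesis using that[of ?Q] \<open>0 \<le> B\<close> by simp
qed

lemma run_radius_positive:
  assumes vp: "valid_params T" and run: "trust_region_run sm P r1 T solver R"
  shows "0 < itD R k"
proof (induction k)
  case 0
  show ?case using run by (simp add: trust_region_run_def)
next
  case (Suc k)
  let ?\<rho> = "rho sm P T solver R k"
  have u: "if ?\<rho> \<ge> eta2 T
           then itD R (Suc k) \<in> {min (gamma3 T * itD R k) (Delta_max T) .. Delta_max T}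
           else if ?\<rho> \<ge> eta1 T
           then itD R (Suc k) \<in> {gamma2 T * itD R k .. itD R k}
           else itD R (Suc k) \<in> {gamma1 T * itD R k .. gamma2 T * itD R k}"
    using run unfolding trust_region_run_def Let_def by blast
  have "0 < gamma1 T" "0 < gamma2 T" "0 < gamma3 T" "0 < Delta_max T"
    using vp unfolding valid_params_def by linarith+
  with Suc have "0 < gamma1 T * itD R k" "0 < gamma2 T * itD R k" "0 < min (gamma3 T * itD R k) (Delta_max T)"
    by auto
  with u show ?case by (auto split: if_splits)
qed

lemma run_predicted_reduction_nonneg:
  assumes vp: "valid_params T" and run: "trust_region_run sm P r1 T solver R"
  shows "run_model sm P T R k (itp R k) \<le> run_model sm P T R k 0"
  using run run_radius_positive[OF vp run, of k] unfolding trust_region_run_def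
  by (metis less_imp_le norm_zero)

text \<open>A ratio of at least \<open>eta1 > 0\<close> excludes a vanishing predicted reduction, since division by zero
  yields zero.\<close>

lemma accepted_step_reduction:
  assumes vp: "valid_params T" and run: "trust_region_run sm P r1 T solver R"
    and acc: "eta1 T \<le> rho sm P T solver R k"
  shows "eta1 T * (run_model sm P T R k 0 - run_model sm P T R k (itp R k))
    \<le> merit sm P (penalty T) (itx R k) (itv R k) - merit sm P (penalty T) (itx R (Suc k)) (itv R (Suc k))"
proof -
  let ?p = "run_model sm P T R k 0 - run_model sm P T R k (itp R k)"
  let ?a = "merit sm P (penalty T) (itx R k) (itv R k) - merit sm P (penalty T) (itx R k + itp R k) (trial_v solver R k)"
  have e: "0 < eta1 T" using vp by (simp add: valid_params_def)
  have a: "eta1 T \<le> ?a / ?p" using acc by (simp add: rho_def)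
  have "?p \<noteq> 0" using a e by auto
  moreover have "0 \<le> ?p" using run_predicted_reduction_nonneg[OF vp run, of k] by simp
  ultimately have "0 < ?p" by linarith
  then have "eta1 T * ?p \<le> ?a" using a by (simp add: pos_le_divide_eq)
  moreover have "itx R (Suc k) = itx R k + itp R k \<and> (\<forall>i\<in>{1..N P}. itv R (Suc k) i = trial_v solver R k i)"
    using run acc unfolding trust_region_run_def Let_def by meson
  then have "merit sm P (penalty T) (itx R (Suc k)) (itv R (Suc k))
      = merit sm P (penalty T) (itx R k + itp R k) (trial_v solver R k)"
    unfolding merit_l1[of _ _ _ _ "trial_v solver R k"] by (intro trans[OF merit_cong]) auto
  ultimately show ?thesis by simp
qed

lemma rejected_step:
  assumes run: "trust_region_run sm P r1 T solver R"
    and rej: "\<not> eta1 T \<le> rho sm P T solver R k"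
  shows "itx R (Suc k) = itx R k" "\<And>i. i \<in> {1..N P} \<Longrightarrow> itv R (Suc k) i = itv R k i"
    "merit sm P \<pi> (itx R (Suc k)) (itv R (Suc k)) = merit sm P \<pi> (itx R k) (itv R k)"
proof -
  have 1: "itx R (Suc k) = itx R k \<and> (\<forall>i\<in>{1..N P}. itv R (Suc k) i = itv R k i)"
    using run rej unfolding trust_region_run_def Let_def by meson
  then show "itx R (Suc k) = itx R k" "\<And>i. i \<in> {1..N P} \<Longrightarrow> itv R (Suc k) i = itv R k i" by auto
  show "merit sm P \<pi> (itx R (Suc k)) (itv R (Suc k)) = merit sm P \<pi> (itx R k) (itv R k)"
    unfolding merit_l1[of _ _ _ _ "itv R k"] using 1 by (intro trans[OF merit_cong]) auto
qed

lemma run_merit_decseq: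
  assumes vp: "valid_params T" and run: "trust_region_run sm P r1 T solver R"
  shows "decseq (\<lambda>k. merit sm P (penalty T) (itx R k) (itv R k))"
proof (rule decseq_SucI)
  fix k
  show "merit sm P (penalty T) (itx R (Suc k)) (itv R (Suc k)) \<le> merit sm P (penalty T) (itx R k) (itv R k)"
  proof (cases "eta1 T \<le> rho sm P T solver R k")
    case True
    have "0 < eta1 T" using vp by (simp add: valid_params_def)
    with run_predicted_reduction_nonneg[OF vp run, of k]
    have "0 \<le> eta1 T * (run_model sm P T R k 0 - run_model sm P T R k (itp R k))" by simp
    with accepted_step_reduction[OF vp run True] show ?thesis by simp
  next
    case False
    then show ?thesis using rejected_step(3)[OF run] by simp
  qed
qed

theorem theorem5p10:
  fixes P :: "('p::finite,'q::finite,'n::finite,'m::finite) two_stage"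
    and sm :: smoothing
    and T :: tr_params
    and solver :: "('p,'n,'m) solver"
    and R :: "('p,'n,'m) tr_run"
    and r1 r2 :: "nat \<Rightarrow> real^'p \<Rightarrow> ('p,'n,'m) sub_vars \<Rightarrow> real"
    and xinf :: "real^'p"
    and vinf :: "nat \<Rightarrow> ('p,'n,'m) sub_vars"
  assumes "well_formed P"
    and "valid_params T"
    and "\<And>i xb vb. i \<in> {1..N P} \<Longrightarrow> nondegenerate P i xb vb \<Longrightarrow>
           admissible_radii P i xb vb (r1 i xb vb) (r2 i xb vb)"
    and "trust_region_run sm P r1 T solver R"
    and "feasibility_assumption P solver R"
    and "regularity_assumption sm P"
    and "consistent_output_assumption P r2 solver R"
    and "bounded (range (itH R))"
    and "limit_point_of_run P R xinf vinf"
    and "\<And>i. i \<in> {1..N P} \<Longrightarrow> KKT_jacobian_nonsingular P i xinf (vinf i)"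
  shows "stationary_point (local_merit sm P r1 (penalty T) xinf vinf) xinf"
proof (rule ccontr)
  note wf = assms(1) and vp = assms(2) and radii = assms(3) and run = assms(4) and feas = assms(5)
    and reg = assms(6) and cons = assms(7)
  let ?\<pi> = "penalty T" and ?I = "{1..N P}"
  assume ns: "\<not> stationary_point (local_merit sm P r1 ?\<pi> xinf vinf) xinf"
  have par: "0 < Delta_max T" "0 < ?\<pi>" "0 < eta1 T" "eta1 T \<le> eta2 T" "eta2 T < 1"
    "0 < gamma1 T" "gamma1 T \<le> gamma2 T" "gamma2 T < 1" "1 < gamma3 T"
    using vp unfolding valid_params_def by linarith+
  obtain r where r: "strict_mono r" "(\<lambda>n. itx R (r n)) \<longlonglongrightarrow> xinf"
    "\<And>i. i \<in> ?I \<Longrightarrow> (\<lambda>n. itv R (r n) i) \<longlonglongrightarrow> vinf i"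
    using assms(9) unfolding limit_point_of_run_def by blast
  have nd: "nondegenerate P i xinf (vinf i)" if i: "i \<in> ?I" for i
    unfolding nondegenerate_def
    using KKT_set_closed_under_limits[OF wf reg i r(2) r(3)[OF i] iterates_KKT[OF run feas i]] assms(10)[OF i]
    by blast
  define w where "w i = local_solution_map P i xinf (vinf i) (r1 i xinf (vinf i))" for i
  define lf where "lf i = local_fhat sm P r1 i xinf (vinf i)" for i
  have lf: "fhat sm P i x (w i x) = lf i x" for i x by (simp add: lf_def local_fhat_def w_def)
  define good where "good k \<longleftrightarrow> (\<forall>i\<in>?I. itv R k i = w i (itx R k))" for k
  have "\<forall>i\<in>?I. \<exists>s>0. C1_on (ball xinf s) (lf i)
    \<and> (\<forall>k. itx R k \<in> ball xinf s \<longrightarrow> itv R k i = w i (itx R k) \<longrightarrow>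
         GDERIV (lf i) (itx R k) :> itg R k i \<and>
         (norm (itp R k) \<le> s \<longrightarrow> trial_v solver R k i = w i (itx R k + itp R k)))
    \<and> eventually (\<lambda>n. itv R (r n) i = w i (itx R (r n))) sequentially"
    using subproblem_data_near_limit[OF wf reg _ radii run feas cons nd r(2) r(3)]
    unfolding lf_def w_def by blast
  then obtain s where s: "\<And>i. i \<in> ?I \<Longrightarrow> 0 < s i" "\<And>i. i \<in> ?I \<Longrightarrow> C1_on (ball xinf (s i)) (lf i)"
    "\<And>i k. i \<in> ?I \<Longrightarrow> itx R k \<in> ball xinf (s i) \<Longrightarrow> itv R k i = w i (itx R k) \<Longrightarrow> GDERIV (lf i) (itx R k) :> itg R k i"
    "\<And>i k. i \<in> ?I \<Longrightarrow> itx R k \<in> ball xinf (s i) \<Longrightarrow> itv R k i = w i (itx R k) \<Longrightarrow> norm (itp R k) \<le> s i \<Longrightarrow>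
        trial_v solver R k i = w i (itx R k + itp R k)"
    "\<And>i. i \<in> ?I \<Longrightarrow> eventually (\<lambda>n. itv R (r n) i = w i (itx R (r n))) sequentially"
    by (subst (asm) bchoice_iff) blast
  \<comment> \<open>a radius that serves all subproblems; 1 covers the case of no subproblem\<close>
  define s0 where "s0 = Min (insert 1 (s ` ?I))"
  have s0: "0 < s0" "\<And>i. i \<in> ?I \<Longrightarrow> s0 \<le> s i"
    unfolding s0_def using s(1) by (auto simp del: Min_insert intro!: Min_le)
  have "eventually (\<lambda>n. \<forall>i\<in>?I. itv R (r n) i = w i (itx R (r n))) sequentially"
    by (intro eventually_ball_finite ballI s(5)) auto
  then have good_lim: "eventually (\<lambda>n. good (r n)) sequentially" by (simp add: good_def)

  define \<psi> where "\<psi> x = f0 P x + (\<Sum>i\<in>?I. lf i x)" for x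
  have C1f0: "C1_on U (f0 P)" and C1c0: "C1_on U (c0 P)" for U
    using reg by (auto simp: regularity_assumption_def intro: C1_lip_C1)
  have \<psi>C1: "C1_on (ball xinf s0) \<psi>"
    unfolding \<psi>_def[abs_def]
    by (intro C1_on_add C1f0 C1_on_sum C1_on_subset[OF s(2)] subset_ball s0)
  obtain g where g: "\<And>x. x \<in> ball xinf s0 \<Longrightarrow> GDERIV \<psi> x :> g x"
    using C1_on_GDERIV[OF \<psi>C1] by metis
  define C where "C x = (\<lambda>d. jacobian (c0 P) (at x) *v d)" for x
  have C: "(c0 P has_derivative C x) (at x)" for x
  proof -
    have "c0 P differentiable at x"
      using C1c0[of UNIV] unfolding C1_on_def is_derivative_on_def differentiable_def by blast
    then show ?thesis unfolding C_def by (simp add: jacobian_works)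
  qed
  have merit_good: "merit sm P ?\<pi> (itx R k) (itv R k) = \<psi> (itx R k) + ?\<pi> * l1_violation (c0 P (itx R k))"
    if "good k" for k
    unfolding \<psi>_def by (rule merit_cong) (use that in \<open>simp add: good_def lf\<close>)
  have model_good: "run_model sm P T R k p = \<psi> (itx R k) + g (itx R k) \<bullet> p + 1/2 * (p \<bullet> (itH R k *v p))
      + ?\<pi> * l1_violation (c0 P (itx R k) + C (itx R k) p)"
    if k: "good k" "itx R k \<in> ball xinf s0" for k p
  proof -
    obtain gf where "\<And>x. x \<in> UNIV \<Longrightarrow> GDERIV (f0 P) x :> gf x" using C1_on_GDERIV[OF C1f0] by metis
    then have f: "GDERIV (f0 P) (itx R k) :> grad (f0 P) (itx R k)" by (metis UNIV_I grad_eq)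
    have "GDERIV (lf i) (itx R k) :> itg R k i" if "i \<in> ?I" for i
    proof (rule s(3)[OF that])
      show "itx R k \<in> ball xinf (s i)" using k(2) s0(2)[OF that] by simp
      show "itv R k i = w i (itx R k)" using k(1) that by (simp add: good_def)
    qed
    then have "GDERIV \<psi> (itx R k) :> grad (f0 P) (itx R k) + (\<Sum>i\<in>?I. itg R k i)"
      using f unfolding \<psi>_def[abs_def] gderiv_def inner_add_right inner_sum_right
      by (intro has_derivative_add has_derivative_sum)
    then have "g (itx R k) = grad (f0 P) (itx R k) + (\<Sum>i\<in>?I. itg R k i)"
      using g[OF k(2)] grad_eq by metis
    moreover have "(\<Sum>i\<in>?I. fhat sm P i (itx R k) (itv R k i)) = (\<Sum>i\<in>?I. lf i (itx R k))"
      using k(1) by (intro sum.cong refl) (simp only: good_def lf)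
    ultimately show ?thesis unfolding run_model_l1 \<psi>_def C_def by simp
  qed

  obtain Q where Q: "0 \<le> Q" "\<And>k p. \<bar>p \<bullet> (itH R k *v p)\<bar> \<le> Q * (norm p)\<^sup>2"
    using bounded_quadratic_forms[OF assms(8)] by metis
  have "local_merit sm P r1 ?\<pi> xinf vinf = (\<lambda>x. \<psi> x + ?\<pi> * l1_violation (c0 P x))"
    by (simp add: fun_eq_iff local_merit_def \<psi>_def lf_def l1_violation_def)
  with ns have ns': "\<not> stationary_point (\<lambda>x. \<psi> x + ?\<pi> * l1_violation (c0 P x)) xinf" by simp
  have eps: "0 < 1 - eta2 T" using par(5) by simp
  \<comment> \<open>model error at most the fraction \<open>1 - eta2\<close> of the predicted reduction means \<open>\<rho> \<ge> eta2\<close>\<close>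
  obtain \<sigma> \<delta>' \<kappa> where \<sigma>: "0 < \<sigma>" "\<sigma> \<le> s0" and \<delta>': "0 < \<delta>'" and \<kappa>: "0 < \<kappa>"
    and pred: "\<And>x h D. x \<in> ball xinf \<sigma> \<Longrightarrow> (\<And>p. \<bar>h p\<bar> \<le> Q * (norm p)\<^sup>2) \<Longrightarrow> 0 < D \<Longrightarrow>
       \<exists>q. norm q \<le> D \<and> g x \<bullet> q + 1/2 * h q + ?\<pi> * l1_violation (c0 P x + C x q)
           \<le> ?\<pi> * l1_violation (c0 P x) - \<kappa> * min \<delta>' D"
    and err: "\<And>x h p. x \<in> ball xinf \<sigma> \<Longrightarrow> (\<And>p. \<bar>h p\<bar> \<le> Q * (norm p)\<^sup>2) \<Longrightarrow> norm p \<le> \<delta>' \<Longrightarrow>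
       \<bar>\<psi> (x + p) + ?\<pi> * l1_violation (c0 P (x + p))
         - (\<psi> x + g x \<bullet> p + 1/2 * h p + ?\<pi> * l1_violation (c0 P x + C x p))\<bar> \<le> (1 - eta2 T) * \<kappa> * norm p"
    using nonstationary_model_estimates[OF s0(1) \<psi>C1 C1c0 g C par(2) eps Q(1) ns'] by metis
  define \<delta> where "\<delta> = min \<delta>' (min s0 (Delta_max T))"
  have \<delta>: "0 < \<delta>" "\<delta> \<le> \<delta>'" "\<delta> \<le> s0" "\<delta> \<le> Delta_max T" using \<delta>' s0 par by (auto simp: \<delta>_def)

  define M where "M k = merit sm P ?\<pi> (itx R k) (itv R k)" for k
  have Dpos: "0 < itD R k" for k by (rule run_radius_positive[OF vp run])
  have pD: "norm (itp R k) \<le> itD R k" for k using run unfolding trust_region_run_def by blast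
  have pred_k: "\<kappa> * min \<delta> (itD R k) \<le> run_model sm P T R k 0 - run_model sm P T R k (itp R k)"
    if k: "dist (itx R k) xinf < \<sigma>" "good k" for k
  proof -
    have x: "itx R k \<in> ball xinf \<sigma>" "itx R k \<in> ball xinf s0" using k(1) \<sigma> by (auto simp: dist_commute)
    obtain q where q: "norm q \<le> itD R k"
      "g (itx R k) \<bullet> q + 1/2 * (q \<bullet> (itH R k *v q)) + ?\<pi> * l1_violation (c0 P (itx R k) + C (itx R k) q)
           \<le> ?\<pi> * l1_violation (c0 P (itx R k)) - \<kappa> * min \<delta>' (itD R k)"
      using pred[OF x(1), of "\<lambda>q. q \<bullet> (itH R k *v q)", OF Q(2) Dpos] by blast
    have "run_model sm P T R k (itp R k) \<le> run_model sm P T R k q"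
      using run q(1) unfolding trust_region_run_def by blast
    also have "\<dots> \<le> run_model sm P T R k 0 - \<kappa> * min \<delta>' (itD R k)"
      using q(2) unfolding run_model_zero merit_good[OF k(2)] model_good[OF k(2) x(2)] by simp
    finally have "\<kappa> * min \<delta>' (itD R k) \<le> run_model sm P T R k 0 - run_model sm P T R k (itp R k)" by simp
    moreover have "\<kappa> * min \<delta> (itD R k) \<le> \<kappa> * min \<delta>' (itD R k)" using \<kappa> \<delta> by (intro mult_left_mono) auto
    ultimately show ?thesis by simp
  qed
  have Mlim: "(\<lambda>n. M (r n)) \<longlonglongrightarrow> \<psi> xinf + ?\<pi> * l1_violation (c0 P xinf)"
  proof (rule Lim_transform_eventually)
    have "isCont \<psi> xinf"
      using C1_on_continuous[OF \<psi>C1] s0(1) by (simp add: continuous_on_eq_continuous_at)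
    moreover have "isCont (\<lambda>x. l1_violation (c0 P x)) xinf"
      using continuous_on_compose2[OF l1_violation_continuous C1_on_continuous[OF C1c0[of UNIV]]]
      by (simp add: continuous_on_eq_continuous_at)
    ultimately show "(\<lambda>n. \<psi> (itx R (r n)) + ?\<pi> * l1_violation (c0 P (itx R (r n)))) \<longlonglongrightarrow>
        \<psi> xinf + ?\<pi> * l1_violation (c0 P xinf)"
      by (intro tendsto_add tendsto_mult tendsto_const isCont_tendsto_compose[OF _ r(2)])
    show "eventually (\<lambda>n. \<psi> (itx R (r n)) + ?\<pi> * l1_violation (c0 P (itx R (r n))) = M (r n)) sequentially"
      using good_lim by eventually_elim (simp add: M_def merit_good)
  qed
  show False
  proof (rule trust_region_sequence_no_uniform_decrease[where x = "itx R" and D = "itD R" and M = M and good = good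
        and acc = "\<lambda>k. eta1 T \<le> rho sm P T solver R k" and a = "eta1 T * \<kappa>" and \<sigma> = \<sigma> and \<delta> = \<delta>
        and Dmax = "Delta_max T" and ?c1.0 = "gamma1 T" and ?c2.0 = "gamma2 T" and ?c3.0 = "gamma3 T"
        and r = r and xb = xinf, OF _ \<sigma>(1) \<delta>(1,4) par(6) _ par(8,7,9) Dpos _ r(1,2) Mlim good_lim])
    show "0 < eta1 T * \<kappa>" using par \<kappa> by simp
    show "0 < gamma2 T" using par by simp
    show "decseq M" unfolding M_def[abs_def] by (rule run_merit_decseq[OF vp run])
  next
    fix k assume k: "dist (itx R k) xinf < \<sigma>" "good k" and acc: "eta1 T \<le> rho sm P T solver R k"
    have "eta1 T * (\<kappa> * min \<delta> (itD R k)) \<le> eta1 T * (run_model sm P T R k 0 - run_model sm P T R k (itp R k))"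
      using pred_k[OF k] par by (intro mult_left_mono) auto
    with accepted_step_reduction[OF vp run acc]
    show "eta1 T * \<kappa> * min \<delta> (itD R k) \<le> M k - M (Suc k)" by (simp add: M_def mult.assoc)
  next
    fix k assume k: "dist (itx R k) xinf < \<sigma>" "good k" and D: "itD R k \<le> \<delta>"
    have x: "itx R k \<in> ball xinf \<sigma>" "itx R k \<in> ball xinf s0" using k(1) \<sigma> by (auto simp: dist_commute)
    let ?x = "itx R k" and ?p = "itp R k"
    let ?pred = "run_model sm P T R k 0 - run_model sm P T R k ?p"
    have p: "norm ?p \<le> \<delta>'" "norm ?p \<le> s0" using pD[of k] D \<delta> by auto
    have tr: "trial_v solver R k i = w i (?x + ?p)" if "i \<in> ?I" for i
    proof (rule s(4)[OF that])
      show "?x \<in> ball xinf (s i)" using x(2) s0(2)[OF that] by simp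
      show "itv R k i = w i ?x" using k(2) that by (simp add: good_def)
      show "norm ?p \<le> s i" using p(2) s0(2)[OF that] by simp
    qed
    have mt: "merit sm P ?\<pi> (?x + ?p) (trial_v solver R k) = \<psi> (?x + ?p) + ?\<pi> * l1_violation (c0 P (?x + ?p))"
      unfolding \<psi>_def by (rule merit_cong) (simp only: tr lf)
    have pr: "\<kappa> * itD R k \<le> ?pred" using pred_k[OF k] D by (simp add: min_def split: if_splits)
    have "\<bar>merit sm P ?\<pi> (?x + ?p) (trial_v solver R k) - run_model sm P T R k ?p\<bar> \<le> (1 - eta2 T) * \<kappa> * norm ?p"
      using err[OF x(1), of "\<lambda>q. q \<bullet> (itH R k *v q)", OF Q(2) p(1)] unfolding mt model_good[OF k(2) x(2)] .
    also have "\<dots> \<le> (1 - eta2 T) * \<kappa> * itD R k"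
      using pD[of k] par \<kappa> by (intro mult_left_mono) auto
    also have "\<dots> \<le> (1 - eta2 T) * ?pred"
      unfolding mult.assoc using pr par by (intro mult_left_mono) auto
    finally have "eta2 T * ?pred \<le> merit sm P ?\<pi> ?x (itv R k) - merit sm P ?\<pi> (?x + ?p) (trial_v solver R k)"
      unfolding run_model_zero by (simp add: algebra_simps abs_le_iff)
    moreover have "0 < \<kappa> * itD R k" using \<kappa> Dpos[of k] by simp
    then have "0 < ?pred" using pr by linarith
    ultimately have rho2: "eta2 T \<le> rho sm P T solver R k"
      unfolding rho_def by (simp add: pos_le_divide_eq)
    then have rho1: "eta1 T \<le> rho sm P T solver R k" using par by simp
    have step: "itx R (Suc k) = ?x + ?p \<and> (\<forall>i\<in>?I. itv R (Suc k) i = trial_v solver R k i)"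
      using run rho1 unfolding trust_region_run_def Let_def by meson
    have "itD R (Suc k) \<in> {min (gamma3 T * itD R k) (Delta_max T) .. Delta_max T}"
      using run rho2 unfolding trust_region_run_def Let_def by meson
    with rho1 step tr pD[of k]
    show "eta1 T \<le> rho sm P T solver R k \<and> good (Suc k) \<and> dist (itx R (Suc k)) (itx R k) \<le> itD R k \<and>
        min (gamma3 T * itD R k) (Delta_max T) \<le> itD R (Suc k)"
      by (simp add: good_def dist_norm)
  next
    fix k assume rej: "\<not> eta1 T \<le> rho sm P T solver R k"
    then have "\<not> eta2 T \<le> rho sm P T solver R k" using par by simp
    with rej have "itD R (Suc k) \<in> {gamma1 T * itD R k .. gamma2 T * itD R k}"
      using run unfolding trust_region_run_def Let_def by meson
    with rejected_step(1,2)[OF run rej]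
    show "itx R (Suc k) = itx R k \<and> (good k \<longrightarrow> good (Suc k)) \<and>
        gamma1 T * itD R k \<le> itD R (Suc k) \<and> itD R (Suc k) \<le> gamma2 T * itD R k"
      by (auto simp: good_def)
  qed
qed

end
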